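(* Let $n\ge 3$, $q=\frac{2n}{n-2}$, $\kappa=\frac{n-1}{n}$. Identify $S^1$ with $[-\pi,\pi]$ with endpoints identified, and let $\lambda=-1$ on $(-\pi,0)$, $\lambda=1$ on $(0,\pi)$. For $t\in\mathbb{R}$ let $\tau_t=t+\lambda$. Let $N$ be a smooth positive function on $S^1$, let $\gamma_N=-\frac{\int_{S^1}\lambda N}{\int_{S^1}N}$, and let $\eta,\mu\in\mathbb{R}$. Consider the system $$-2\kappa q\,\phi''-2\eta^2\phi^{-q-1}-\kappa\Big(\mu+\tfrac{1}{2N}w'\Big)^2\phi^{-q-1}+\kappa\tau_t^2\phi^{q-1}=0,\qquad \Big(\tfrac{1}{2N}w'\Big)'-\phi^q\tau_t'=0$$ on $S^1$. Suppose $|t|>|\gamma_N|$ and $|t|\neq1$. If $\mu\neq0$ or $\eta\neq0$, and $|\mu|$ and $|\eta|$ are sufficiently small (smallness depending on $n,t,N$), then there exists at least one solution.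
   Context: Here $\tau_t'=2(\delta_0-\delta_\pi)$ is the distributional derivative ($\delta_x$ the Dirac mass at $x$), and the second equation is understood in the sense of distributions. A solution is a pair $(\phi,w)\in W^{2,p}_+(S^1)\times W^{1,p}(S^1)$ for some $p>1$, where the subscript $+$ denotes positive functions. *)

theory Defs
  imports "HOL-Analysis.Analysis"
begin

text \<open>S^1 is identified with [-pi,pi] with endpoints glued; functions on S^1 are
  2pi-periodic functions on the real line.\<close>

definition periodic2pi :: "(real \<Rightarrow> real) \<Rightarrow> bool" where
  "periodic2pi f \<longleftrightarrow> (\<forall>x. f (x + 2 * pi) = f x)"

text \<open>lambda = -1 on (-pi,0), 1 on (0,pi) (value at 0, pi irrelevant), extended periodically.\<close>
definition lam :: "real \<Rightarrow> real" where
  "lam x = sgn (sin x)"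

definition tau :: "real \<Rightarrow> real \<Rightarrow> real" where
  "tau t x = t + lam x"

definition smooth_fun :: "(real \<Rightarrow> real) \<Rightarrow> bool" where
  "smooth_fun f \<longleftrightarrow> (\<forall>k x. ((deriv ^^ k) f) differentiable (at x))"

definition Lp_S1 :: "real \<Rightarrow> (real \<Rightarrow> real) \<Rightarrow> bool" where
  "Lp_S1 p h \<longleftrightarrow> h \<in> borel_measurable lborel \<and> periodic2pi h \<and>
     set_integrable lborel {-pi..pi} (\<lambda>x. \<bar>h x\<bar> powr p)"

definition W1p_S1 :: "real \<Rightarrow> (real \<Rightarrow> real) \<Rightarrow> (real \<Rightarrow> real) \<Rightarrow> bool" where
  "W1p_S1 p w v \<longleftrightarrow> periodic2pi w \<and> Lp_S1 p v \<and>
     (\<forall>x. w x = w 0 + (LBINT s=0..x. v s))"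

definition W2p_S1 :: "real \<Rightarrow> (real \<Rightarrow> real) \<Rightarrow> (real \<Rightarrow> real) \<Rightarrow> (real \<Rightarrow> real) \<Rightarrow> bool" where
  "W2p_S1 p phi g h \<longleftrightarrow> periodic2pi phi \<and> (\<forall>x. (phi has_real_derivative g x) (at x)) \<and>
     W1p_S1 p g h"

definition gammaN :: "(real \<Rightarrow> real) \<Rightarrow> real" where
  "gammaN N = - integral {-pi..pi} (\<lambda>x. lam x * N x) / integral {-pi..pi} N"

text \<open>Solution of the system, with q = 2n/(n-2), kappa = (n-1)/n.
  The first equation holds a.e. (phi'' = h, w' = v).  The second equation is tested
  against smooth periodic test functions psi; tau_t' = 2(delta_0 - delta_pi), so
  <phi^q tau_t', psi> = 2 phi(0)^q psi(0) - 2 phi(pi)^q psi(pi), and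
  <((1/(2N)) w')', psi> = - int (w'/(2N)) psi'.\<close>
definition is_solution :: "nat \<Rightarrow> real \<Rightarrow> (real \<Rightarrow> real) \<Rightarrow> real \<Rightarrow> real \<Rightarrow>
    (real \<Rightarrow> real) \<Rightarrow> (real \<Rightarrow> real) \<Rightarrow> bool" where
  "is_solution n t N \<eta> \<mu> phi w \<longleftrightarrow>
    (let q = 2 * real n / (real n - 2); \<kappa> = (real n - 1) / real n in
     \<exists>p>1. \<exists>g h v.
       W2p_S1 p phi g h \<and> (\<forall>x. phi x > 0) \<and> W1p_S1 p w v \<and>
       (AE x in lborel.
          - 2 * \<kappa> * q * h x - 2 * \<eta>\<^sup>2 * phi x powr (- q - 1)
          - \<kappa> * (\<mu> + v x / (2 * N x))\<^sup>2 * phi x powr (- q - 1)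
          + \<kappa> * (tau t x)\<^sup>2 * phi x powr (q - 1) = 0) \<and>
       (\<forall>\<psi>. smooth_fun \<psi> \<and> periodic2pi \<psi> \<longrightarrow>
          - (LBINT x=-pi..pi. v x / (2 * N x) * deriv \<psi> x)
            = 2 * phi 0 powr q * \<psi> 0 - 2 * phi pi powr q * \<psi> pi))"

end

theory Submission
  imports Defs
begin

text \<open>The second equation says exactly that \<open>\<phi>(0) = \<phi>(\<pi>)\<close> and \<open>w' = 2 N \<phi>(0)^q (\<lambda> + \<gamma>\<^sub>N)\<close>. Put
  \<open>M = sqrt (\<kappa> \<mu>^2 + 2 \<eta>^2)\<close> and \<open>\<phi> = d u\<close> with \<open>u(0) = 1\<close>. With \<open>y = M / d^q\<close> and \<open>\<alpha> = \<mu> / M\<close> the first equation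
  becomes \<open>u'' = \<delta> F(\<alpha>, y, u)\<close>, where \<open>\<delta> = M^(1 - 2/q) / (2 \<kappa> q)\<close> is small. Integrability over the circle
  forces \<open>F\<close> to have mean zero, a quadratic equation for \<open>y\<close> given \<open>u\<close>; near \<open>u = 1\<close> its leading
  and constant coefficients have opposite signs because \<open>|t| > |\<gamma>\<^sub>N|\<close>, so \<open>y\<close> is its positive root, bounded away from zero
  uniformly in \<open>\<alpha>\<close>. What remains is a fixed point equation \<open>u = 1 + \<delta> K(\<alpha>, u)\<close> with \<open>K\<close> bounded and Lipschitz,
  solved by contraction. Looking for \<open>u\<close> invariant under \<open>x \<mapsto> \<pi> - x\<close>, i.e. as a function of \<open>arcsin (sin x)\<close>,
  makes \<open>\<phi>(0) = \<phi>(\<pi>)\<close> automatic.\<close>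

section \<open>Integrals over bounded intervals\<close>

text \<open>Oriented integral with real endpoints: splitting and sign changes need no ordering of
  the endpoints, and the coercion to \<open>ereal\<close> is confined to this name.\<close>

definition ibint :: "real \<Rightarrow> real \<Rightarrow> (real \<Rightarrow> real) \<Rightarrow> real" where
  "ibint a b f = (LBINT x=ereal a..ereal b. f x)"

definition locint :: "(real \<Rightarrow> real) \<Rightarrow> bool" where
  "locint f \<longleftrightarrow> f \<in> borel_measurable borel \<and>
     (\<forall>a b. interval_lebesgue_integrable lborel (ereal a) (ereal b) f)"

lemma locint_measurable: "locint f \<Longrightarrow> f \<in> borel_measurable borel"
  by (simp add: locint_def)

lemma locint_interval:
  "locint f \<Longrightarrow> interval_lebesgue_integrable lborel (ereal a) (ereal b) f"
  by (simp add: locint_def)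

lemma locint_Icc:
  assumes "locint f"
  shows "set_integrable lborel {a..b} f"
proof (cases "a \<le> b")
  case True
  \<comment> \<open>\<open>interval_lebesgue_integrable\<close> speaks of open intervals, so the
    closed one is caught inside a larger open one.\<close>
  have "set_integrable lborel {a-1<..<b+1} f"
    using locint_interval[OF assms, of "a-1" "b+1"] True
    by (simp add: interval_lebesgue_integrable_def)
  then show ?thesis
    by (rule set_integrable_subset) auto
qed (simp add: set_integrable_def)

lemma locint_bounded:
  assumes "f \<in> borel_measurable borel" and "\<And>a b x. a \<le> x \<Longrightarrow> x \<le> b \<Longrightarrow> \<bar>f x\<bar> \<le> C a b"
  shows "locint f"
proof -
  have *: "set_integrable lborel {a<..<b} f" for a b
    unfolding set_integrable_def
  proof (rule Bochner_Integration.integrable_bound)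
    show "integrable lborel (\<lambda>x. indicator {a<..<b} x * C a b)"
      by (cases "a \<le> b") auto
    show "AE x in lborel. norm (indicat_real {a<..<b} x *\<^sub>R f x) \<le> norm (indicat_real {a<..<b} x * C a b)"
      using assms(2)[of a _ b] by (intro AE_I2) (auto simp: indicator_def intro: order_trans[OF _ abs_ge_self])
  qed (use assms(1) in measurable)
  show ?thesis
    using assms(1) by (auto simp: locint_def interval_lebesgue_integrable_def *)
qed

lemma locint_continuous:
  assumes "continuous_on UNIV f"
  shows "locint f"
  unfolding locint_def
proof (intro conjI allI)
  show "f \<in> borel_measurable borel"
    using assms by (rule borel_measurable_continuous_onI)
  show "interval_lebesgue_integrable lborel (ereal a) (ereal b) f" for a b
    using assms by (intro interval_integrable_isCont) (auto simp: continuous_on_eq_continuous_at)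
qed

lemma locint_add: "locint f \<Longrightarrow> locint g \<Longrightarrow> locint (\<lambda>x. f x + g x)"
  and locint_diff: "locint f \<Longrightarrow> locint g \<Longrightarrow> locint (\<lambda>x. f x - g x)"
  and locint_cmult: "locint f \<Longrightarrow> locint (\<lambda>x. c * f x)"
  by (auto simp: locint_def)

lemma ibint_add: "locint f \<Longrightarrow> locint g \<Longrightarrow> ibint a b (\<lambda>x. f x + g x) = ibint a b f + ibint a b g"
  and ibint_diff: "locint f \<Longrightarrow> locint g \<Longrightarrow> ibint a b (\<lambda>x. f x - g x) = ibint a b f - ibint a b g"
  and ibint_cmult: "ibint a b (\<lambda>x. c * f x) = c * ibint a b f"
  and ibint_const: "ibint a b (\<lambda>x. c) = c * (b - a)"
  and ibint_same: "ibint a a f = 0"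
  by (auto simp: ibint_def locint_def)

lemma ibint_swap: "ibint a b f = - ibint b a f"
  unfolding ibint_def by (rule interval_integral_endpoints_reverse)

lemma ibint_concat: "locint f \<Longrightarrow> ibint a b f + ibint b c f = ibint a c f"
  unfolding ibint_def by (rule interval_integral_sum) (simp add: locint_def min_def max_def)

lemma ibint_reflect: "ibint a b (\<lambda>x. f (- x)) = ibint (- b) (- a) f"
  using interval_integral_reflect[of "ereal (-b)" "ereal (-a)" f] by (simp add: ibint_def)

lemma ibint_shift: "ibint a b (\<lambda>x. f (x + c)) = ibint (a + c) (b + c) f"
proof -
  \<comment> \<open>The affine substitution works on indicators of intervals, hence ordered
    endpoints first; the reversed case follows by changing signs.\<close>
  have *: "ibint a b (\<lambda>x. f (x + c)) = ibint (a + c) (b + c) f" if "a \<le> b" for a b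
  proof -
    have "ibint (a + c) (b + c) f = (\<integral>x. indicator {a+c<..<b+c} x * f x \<partial>lborel)"
      using that by (simp add: ibint_def interval_lebesgue_integral_def set_lebesgue_integral_def)
    also have "\<dots> = (\<integral>x. indicator {a+c<..<b+c} (c + 1 * x) * f (c + 1 * x) \<partial>lborel)"
      by (subst lborel_integral_real_affine[where c = 1 and t = c]) auto
    also have "\<dots> = (\<integral>x. indicator {a<..<b} x * f (x + c) \<partial>lborel)"
      by (intro Bochner_Integration.integral_cong) (auto simp: indicator_def algebra_simps)
    also have "\<dots> = ibint a b (\<lambda>x. f (x + c))"
      using that by (simp add: ibint_def interval_lebesgue_integral_def set_lebesgue_integral_def)
    finally show ?thesis ..
  qed
  show ?thesis
    using *[of a b] *[of b a] ibint_swap[of a b] ibint_swap[of "a+c"] by (metis linear)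
qed

lemma ibint_reflect_about: "ibint a b (\<lambda>x. f (c - x)) = ibint (c - b) (c - a) f"
  using ibint_reflect[of a b "\<lambda>x. f (x + c)"] ibint_shift[of "-b" "-a" f c] by simp

lemma ibint_cong: "(\<And>x. min a b < x \<Longrightarrow> x < max a b \<Longrightarrow> f x = g x) \<Longrightarrow> ibint a b f = ibint a b g"
  unfolding ibint_def by (rule interval_integral_cong) (auto simp: einterval_iff min_def max_def split: if_splits)

lemma ibint_bound:
  assumes "locint f" and "\<And>x. min a b \<le> x \<Longrightarrow> x \<le> max a b \<Longrightarrow> \<bar>f x\<bar> \<le> C"
  shows "\<bar>ibint a b f\<bar> \<le> C * \<bar>b - a\<bar>"
proof -
  have *: "\<bar>ibint a b f\<bar> \<le> C * \<bar>b - a\<bar>" if "a \<le> b" and "\<And>x. a \<le> x \<Longrightarrow> x \<le> b \<Longrightarrow> \<bar>f x\<bar> \<le> C" for a b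
  proof -
    have "\<bar>ibint a b f\<bar> = norm (\<integral>x. indicator {a<..<b} x * f x \<partial>lborel)"
      using that by (simp add: ibint_def interval_lebesgue_integral_def set_lebesgue_integral_def)
    also have "\<dots> \<le> (\<integral>x. indicator {a<..<b} x * C \<partial>lborel)"
    proof (rule Bochner_Integration.integral_norm_bound_integral)
      show "integrable lborel (\<lambda>x. indicat_real {a<..<b} x * f x)"
        using locint_interval[OF assms(1), of a b] that(1)
        by (simp add: interval_lebesgue_integrable_def set_integrable_def)
      show "integrable lborel (\<lambda>x. indicat_real {a<..<b} x * C)"
        using that(1) by simp
    qed (use that in \<open>auto simp: indicator_def\<close>)
    also have "\<dots> = C * \<bar>b - a\<bar>"
      using that(1) by simp
    finally show ?thesis .
  qed
  show ?thesis
  proof (cases "a \<le> b")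
    case True
    then show ?thesis using *[of a b] assms(2) by simp
  next
    case False
    then show ?thesis using *[of b a] assms(2) ibint_swap[of a b f] by simp
  qed
qed

lemma ibint_mono:
  assumes "a \<le> b" "locint f" "locint g" "\<And>x. a < x \<Longrightarrow> x < b \<Longrightarrow> f x \<le> g x"
  shows "ibint a b f \<le> ibint a b g"
proof -
  have "(LBINT x:{a<..<b}. f x) \<le> (LBINT x:{a<..<b}. g x)"
    using locint_interval[OF assms(2), of a b] locint_interval[OF assms(3), of a b] assms(1,4)
    by (intro set_integral_mono) (auto simp: interval_lebesgue_integrable_def)
  then show ?thesis
    using assms(1) by (simp add: ibint_def interval_lebesgue_integral_def)
qed

section \<open>Regularity and periodicity of primitives\<close>

lemma ibint_antideriv_continuous:
  assumes "locint f" and "\<And>x. \<bar>f x\<bar> \<le> C"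
  shows "continuous_on UNIV (\<lambda>x. ibint a x f)"
proof -
  \<comment> \<open>The integrand may jump along with \<open>lam\<close>, so continuity of the
    primitive comes from a Lipschitz bound, not from differentiability.\<close>
  have *: "\<bar>ibint a x f - ibint a y f\<bar> \<le> C * \<bar>x - y\<bar>" for x y
    using ibint_bound[OF assms(1), of y x C] ibint_concat[OF assms(1), of a y x] assms(2)
    by (smt (verit))
  have "0 \<le> C" using assms(2)[of 0] by linarith
  then have "C-lipschitz_on UNIV (\<lambda>x. ibint a x f)"
    using * by (intro lipschitz_onI) (simp_all add: dist_real_def)
  then show ?thesis
    by (rule lipschitz_on_continuous_on)
qed

lemma ibint_has_derivative:
  assumes "continuous_on UNIV f"
  shows "((\<lambda>x. ibint a x f) has_real_derivative f x) (at x)"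
proof -
  \<comment> \<open>The margin 1 puts x in the interior, where the derivative within the interval is
    the full derivative.\<close>
  define l u where "l = min a x - 1" and "u = max a x + 1"
  have "((\<lambda>v. LBINT y=a..v. f y) has_vector_derivative (f x)) (at x within {l..u})"
    by (rule interval_integral_FTC2) (use assms in \<open>auto simp: l_def u_def intro: continuous_on_subset\<close>)
  moreover have "at x within {l..u} = at x"
    by (rule at_within_Icc_at) (auto simp: l_def u_def)
  ultimately show ?thesis
    by (simp add: ibint_def has_real_derivative_iff_has_vector_derivative)
qed

lemma ibint_FTC:
  assumes "a \<le> b" "\<And>x. (F has_real_derivative f x) (at x)" "continuous_on UNIV f"
  shows "ibint a b f = F b - F a"
  unfolding ibint_def
  by (rule interval_integral_FTC_finite)
    (use assms in \<open>auto simp: has_real_derivative_iff_has_vector_derivative[symmetric]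
       intro: continuous_on_subset has_field_derivative_at_within\<close>)

text \<open>Meant for products such as \<open>N\<close> times a function of \<open>lam\<close>:
  compactness bounds the continuous factor on each bounded interval, while the other factor is
  bounded globally.\<close>

lemma locint_cont_mult:
  assumes "continuous_on UNIV f" "g \<in> borel_measurable borel" "\<And>x. \<bar>g x\<bar> \<le> C"
  shows "locint (\<lambda>x. f x * g x)"
proof (rule locint_bounded)
  have [measurable]: "f \<in> borel_measurable borel"
    using assms(1) by (rule borel_measurable_continuous_onI)
  note [measurable] = assms(2)
  show "(\<lambda>x. f x * g x) \<in> borel_measurable borel" by measurable
  fix a b x :: real assume x: "a \<le> x" "x \<le> b"
  have "compact ((\<lambda>x. \<bar>f x\<bar>) ` {a..b})"
    using assms(1) by (intro compact_continuous_image continuous_intros) (auto intro: continuous_on_subset)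
  then have "bdd_above ((\<lambda>x. \<bar>f x\<bar>) ` {a..b})"
    by (intro bounded_imp_bdd_above compact_imp_bounded)
  then have "\<bar>f x\<bar> \<le> (SUP x\<in>{a..b}. \<bar>f x\<bar>)"
    using x by (intro cSUP_upper) auto
  then show "\<bar>f x * g x\<bar> \<le> (SUP x\<in>{a..b}. \<bar>f x\<bar>) * C"
    unfolding abs_mult using assms(3)[of x] by (intro mult_mono) auto
qed

lemma ibint_eq_integral: "a \<le> b \<Longrightarrow> locint f \<Longrightarrow> ibint a b f = integral {a..b} f"
  using set_borel_integral_eq_integral(2)[OF locint_Icc, of f a b]
  by (simp add: ibint_def interval_integral_Icc)

text \<open>A full period contributes nothing to the primitive. This is what later closes
  \<open>w\<close> up on the circle.\<close>

lemma ibint_periodic: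
  assumes "locint f" "\<And>x. f (x + 2 * pi) = f x" "ibint (- pi) pi f = 0"
  shows "ibint 0 (x + 2 * pi) f = ibint 0 x f"
  using ibint_shift[of "-pi" 0 f "2*pi"] ibint_shift[of 0 x f "2*pi"]
    ibint_concat[OF assms(1), of "-pi" 0 pi] ibint_concat[OF assms(1), of 0 pi "2*pi"]
    ibint_concat[OF assms(1), of 0 "2*pi" "x + 2*pi"]
  by (simp add: assms(2,3))

section \<open>Families of bounded Lipschitz functionals\<close>

text \<open>Boundedness is carried along with the Lipschitz estimate because only together are they
  stable under products. The constant is uniform in the index, which holds the parameter alpha and,
  where needed, also the point x.\<close>

definition BL :: "'i set \<Rightarrow> 's::metric_space set \<Rightarrow> ('i \<Rightarrow> 's \<Rightarrow> real) \<Rightarrow> bool" where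
  "BL I X f \<longleftrightarrow> (\<exists>C\<ge>0. \<forall>i\<in>I. \<forall>u\<in>X. \<bar>f i u\<bar> \<le> C \<and> (\<forall>v\<in>X. \<bar>f i u - f i v\<bar> \<le> C * dist u v))"

lemma BL_I:
  assumes "\<And>i u. i \<in> I \<Longrightarrow> u \<in> X \<Longrightarrow> \<bar>f i u\<bar> \<le> B"
    and "\<And>i u v. i \<in> I \<Longrightarrow> u \<in> X \<Longrightarrow> v \<in> X \<Longrightarrow> \<bar>f i u - f i v\<bar> \<le> L * dist u v"
  shows "BL I X f"
  unfolding BL_def
proof (intro exI[of _ "\<bar>B\<bar> + \<bar>L\<bar>"] conjI ballI)
  fix i u v assume a: "i \<in> I" "u \<in> X" "v \<in> X"
  have "L * dist u v \<le> (\<bar>B\<bar> + \<bar>L\<bar>) * dist u v"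
    by (intro mult_right_mono) auto
  with a show "\<bar>f i u - f i v\<bar> \<le> (\<bar>B\<bar> + \<bar>L\<bar>) * dist u v"
    using assms(2)[of i u v] by linarith
qed (use assms(1) in \<open>force+\<close>)

lemma BL_E:
  assumes "BL I X f"
  obtains C where "C \<ge> 0" "\<And>i u. i \<in> I \<Longrightarrow> u \<in> X \<Longrightarrow> \<bar>f i u\<bar> \<le> C"
    "\<And>i u v. i \<in> I \<Longrightarrow> u \<in> X \<Longrightarrow> v \<in> X \<Longrightarrow> \<bar>f i u - f i v\<bar> \<le> C * dist u v"
  using assms unfolding BL_def by blast

lemma BL_subset: "BL I X f \<Longrightarrow> Y \<subseteq> X \<Longrightarrow> BL I Y f"
  unfolding BL_def by (meson subsetD)

lemma BL_const: "(\<And>i. i \<in> I \<Longrightarrow> \<bar>c i\<bar> \<le> C) \<Longrightarrow> BL I X (\<lambda>i u. c i)"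
  by (rule BL_I[where B = C and L = 0]) auto

lemma BL_reindex: "BL I X f \<Longrightarrow> (\<And>j. j \<in> J \<Longrightarrow> h j \<in> I) \<Longrightarrow> BL J X (\<lambda>j. f (h j))"
  unfolding BL_def by meson

lemma BL_cong: "BL I X f \<Longrightarrow> (\<And>i u. i \<in> I \<Longrightarrow> u \<in> X \<Longrightarrow> f i u = g i u) \<Longrightarrow> BL I X g"
  unfolding BL_def by (metis (no_types, lifting))

lemma BL_add:
  assumes "BL I X f" "BL I X g"
  shows "BL I X (\<lambda>i u. f i u + g i u)"
proof -
  obtain C where C: "C \<ge> 0" "\<And>i u. i \<in> I \<Longrightarrow> u \<in> X \<Longrightarrow> \<bar>f i u\<bar> \<le> C"
    "\<And>i u v. i \<in> I \<Longrightarrow> u \<in> X \<Longrightarrow> v \<in> X \<Longrightarrow> \<bar>f i u - f i v\<bar> \<le> C * dist u v"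
    using assms(1) by (rule BL_E) blast
  obtain D where D: "D \<ge> 0" "\<And>i u. i \<in> I \<Longrightarrow> u \<in> X \<Longrightarrow> \<bar>g i u\<bar> \<le> D"
    "\<And>i u v. i \<in> I \<Longrightarrow> u \<in> X \<Longrightarrow> v \<in> X \<Longrightarrow> \<bar>g i u - g i v\<bar> \<le> D * dist u v"
    using assms(2) by (rule BL_E) blast
  show ?thesis
  proof (rule BL_I[where B = "C + D" and L = "C + D"])
    fix i u v assume a: "i \<in> I" "u \<in> X" "v \<in> X"
    show "\<bar>f i u + g i u\<bar> \<le> C + D" using C(2)[OF a(1,2)] D(2)[OF a(1,2)] by linarith
    show "\<bar>f i u + g i u - (f i v + g i v)\<bar> \<le> (C + D) * dist u v"
      unfolding distrib_right using C(3)[OF a] D(3)[OF a] by linarith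
  qed
qed

lemma BL_mult:
  assumes "BL I X f" "BL I X g"
  shows "BL I X (\<lambda>i u. f i u * g i u)"
proof -
  obtain C where C: "C \<ge> 0" "\<And>i u. i \<in> I \<Longrightarrow> u \<in> X \<Longrightarrow> \<bar>f i u\<bar> \<le> C"
    "\<And>i u v. i \<in> I \<Longrightarrow> u \<in> X \<Longrightarrow> v \<in> X \<Longrightarrow> \<bar>f i u - f i v\<bar> \<le> C * dist u v"
    using assms(1) by (rule BL_E) blast
  obtain D where D: "D \<ge> 0" "\<And>i u. i \<in> I \<Longrightarrow> u \<in> X \<Longrightarrow> \<bar>g i u\<bar> \<le> D"
    "\<And>i u v. i \<in> I \<Longrightarrow> u \<in> X \<Longrightarrow> v \<in> X \<Longrightarrow> \<bar>g i u - g i v\<bar> \<le> D * dist u v"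
    using assms(2) by (rule BL_E) blast
  show ?thesis
  proof (rule BL_I[where B = "C * D" and L = "2 * C * D"])
    fix i u v assume a: "i \<in> I" "u \<in> X" "v \<in> X"
    show "\<bar>f i u * g i u\<bar> \<le> C * D"
      unfolding abs_mult using C(1) C(2)[OF a(1,2)] D(2)[OF a(1,2)] by (intro mult_mono) auto
    have "f i u * g i u - f i v * g i v = f i u * (g i u - g i v) + (f i u - f i v) * g i v"
      by (simp add: algebra_simps)
    also have "\<bar>\<dots>\<bar> \<le> \<bar>f i u\<bar> * \<bar>g i u - g i v\<bar> + \<bar>f i u - f i v\<bar> * \<bar>g i v\<bar>"
      by (metis abs_mult abs_triangle_ineq)
    also have "\<dots> \<le> C * (D * dist u v) + C * dist u v * D"
      using C(1) C(2)[OF a(1,2)] D(2)[OF a(1,3)] C(3)[OF a] D(3)[OF a]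
      by (intro add_mono mult_mono) auto
    finally show "\<bar>f i u * g i u - f i v * g i v\<bar> \<le> 2 * C * D * dist u v" by simp
  qed
qed

lemma BL_cmult: "BL I X f \<Longrightarrow> BL I X (\<lambda>i u. c * f i u)"
  by (intro BL_mult BL_const[where C = "\<bar>c\<bar>"]) auto

lemma BL_diff: "BL I X f \<Longrightarrow> BL I X g \<Longrightarrow> BL I X (\<lambda>i u. f i u - g i u)"
  using BL_add[of I X f "\<lambda>i u. (-1) * g i u"] BL_cmult[of I X g "-1"] by simp

text \<open>The values stay in a compact interval [c, C] away from zero, where the power and its
  derivative are bounded; the mean value inequality does the rest. Square roots and reciprocals are
  later treated as powers 1/2 and -1.\<close>

lemma BL_powr:
  assumes "BL I X f" and "c > 0" and "\<And>i u. i \<in> I \<Longrightarrow> u \<in> X \<Longrightarrow> c \<le> f i u"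
  shows "BL I X (\<lambda>i u. f i u powr s)"
proof -
  obtain C where C: "C \<ge> 0" "\<And>i u. i \<in> I \<Longrightarrow> u \<in> X \<Longrightarrow> \<bar>f i u\<bar> \<le> C"
    "\<And>i u v. i \<in> I \<Longrightarrow> u \<in> X \<Longrightarrow> v \<in> X \<Longrightarrow> \<bar>f i u - f i v\<bar> \<le> C * dist u v"
    using assms(1) by (rule BL_E) blast
  have mem: "f i u \<in> {c..C}" if "i \<in> I" "u \<in> X" for i u
    using C(2)[OF that] assms(3)[OF that] by auto
  have bnd: "\<exists>B\<ge>0. \<forall>x\<in>{c..C}. \<bar>g x\<bar> \<le> B" if "continuous_on {c..C} g" for g :: "real \<Rightarrow> real"
    using compact_imp_bounded[OF compact_continuous_image[OF that compact_Icc]]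
    unfolding bounded_iff by (metis abs_ge_zero image_eqI order_trans real_norm_def abs_le_D1 dual_order.refl abs_of_nonneg linear)
  obtain B where B: "B \<ge> 0" "\<And>x. x \<in> {c..C} \<Longrightarrow> \<bar>x powr s\<bar> \<le> B"
    using bnd[of "\<lambda>x. x powr s"] assms(2) by (force intro!: continuous_intros)
  obtain L where L: "L \<ge> 0" "\<And>x. x \<in> {c..C} \<Longrightarrow> \<bar>s * x powr (s - 1)\<bar> \<le> L"
    using bnd[of "\<lambda>x. s * x powr (s - 1)"] assms(2) by (force intro!: continuous_intros)
  show ?thesis
  proof (rule BL_I[where B = B and L = "L * C"])
    fix i u v assume a: "i \<in> I" "u \<in> X" "v \<in> X"
    show "\<bar>f i u powr s\<bar> \<le> B" using B(2) mem a by blast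
    have "norm (f i u powr s - f i v powr s) \<le> L * norm (f i u - f i v)"
    proof (rule field_differentiable_bound[where S = "{c..C}"])
      fix x assume x: "x \<in> {c..C}"
      then have "x > 0" using assms(2) by auto
      then show "((\<lambda>x. x powr s) has_field_derivative s * x powr (s - 1)) (at x within {c..C})"
        by (auto intro!: derivative_eq_intros simp: powr_diff)
      show "norm (s * x powr (s - 1)) \<le> L" using L(2)[OF x] by simp
    qed (use mem a in auto)
    also have "\<dots> \<le> L * (C * dist u v)"
      using C(3)[OF a] L(1) by (intro mult_left_mono) auto
    finally show "\<bar>f i u powr s - f i v powr s\<bar> \<le> L * C * dist u v" by simp
  qed
qed

text \<open>The integration variable is part of the index: estimates uniform in x survive
  integration over a bounded interval.\<close>

lemma BL_ibint:
  assumes "BL (I \<times> UNIV) X (\<lambda>(i, x). f i x)"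
    and "\<And>i u. i \<in> I \<Longrightarrow> u \<in> X \<Longrightarrow> locint (\<lambda>x. f i x u)"
  shows "BL I X (\<lambda>i u. ibint a b (\<lambda>x. f i x u))"
proof -
  obtain C where C: "C \<ge> 0" "\<And>i u. i \<in> I \<times> UNIV \<Longrightarrow> u \<in> X \<Longrightarrow> \<bar>(\<lambda>(i, x). f i x) i u\<bar> \<le> C"
    "\<And>i u v. i \<in> I \<times> UNIV \<Longrightarrow> u \<in> X \<Longrightarrow> v \<in> X \<Longrightarrow>
       \<bar>(\<lambda>(i, x). f i x) i u - (\<lambda>(i, x). f i x) i v\<bar> \<le> C * dist u v"
    using assms(1) by (rule BL_E) blast
  show ?thesis
  proof (rule BL_I[where B = "C * \<bar>b - a\<bar>" and L = "C * \<bar>b - a\<bar>"])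
    fix i u v assume a: "i \<in> I" "u \<in> X" "v \<in> X"
    show "\<bar>ibint a b (\<lambda>x. f i x u)\<bar> \<le> C * \<bar>b - a\<bar>"
      using C(2)[of "(i, _)" u] a by (intro ibint_bound assms) auto
    have "\<bar>ibint a b (\<lambda>x. f i x u - f i x v)\<bar> \<le> C * dist u v * \<bar>b - a\<bar>"
      using C(3)[of "(i, _)" u v] a by (intro ibint_bound assms locint_diff) auto
    then show "\<bar>ibint a b (\<lambda>x. f i x u) - ibint a b (\<lambda>x. f i x v)\<bar> \<le> C * \<bar>b - a\<bar> * dist u v"
      using a by (simp add: ibint_diff assms(2) mult_ac)
  qed
qed

section \<open>Double integration of symmetric periodic sources\<close>

text \<open>The base point pi/2 is fixed by the reflection x to pi - x, so a symmetric source gets a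
  primitive odd about it.\<close>

definition antideriv1 :: "(real \<Rightarrow> real) \<Rightarrow> real \<Rightarrow> real" where
  "antideriv1 f x = ibint (pi / 2) x f"

text \<open>The base point 0 yields the normalisation u(0) = 1 when u is 1 plus a multiple of this
  function.\<close>

definition antideriv2 :: "(real \<Rightarrow> real) \<Rightarrow> real \<Rightarrow> real" where
  "antideriv2 f x = ibint 0 x (antideriv1 f)"

lemma antideriv1_continuous: "locint f \<Longrightarrow> (\<And>x. \<bar>f x\<bar> \<le> C) \<Longrightarrow> continuous_on UNIV (antideriv1 f)"
  unfolding antideriv1_def by (rule ibint_antideriv_continuous)

lemma antideriv2_has_derivative:
  "locint f \<Longrightarrow> (\<And>x. \<bar>f x\<bar> \<le> C) \<Longrightarrow> (antideriv2 f has_real_derivative antideriv1 f x) (at x)"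
  unfolding antideriv2_def by (rule ibint_has_derivative[OF antideriv1_continuous])

lemma antideriv2_diff:
  assumes "locint f" "\<And>x. \<bar>f x\<bar> \<le> C" "locint g" "\<And>x. \<bar>g x\<bar> \<le> D"
  shows "antideriv2 (\<lambda>x. f x - g x) y = antideriv2 f y - antideriv2 g y"
proof -
  have "antideriv1 (\<lambda>x. f x - g x) = (\<lambda>x. antideriv1 f x - antideriv1 g x)"
    by (simp add: antideriv1_def ibint_diff assms fun_eq_iff)
  then show ?thesis
    by (simp add: antideriv2_def ibint_diff locint_continuous antideriv1_continuous[OF assms(1,2)] antideriv1_continuous[OF assms(3,4)])
qed

text \<open>For y in [-pi/2, pi/2] both integrations run over lengths at most pi, hence the factor
  pi^2. Arguments of the form \<open>arcsin (sin x)\<close> always lie there.\<close>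

lemma antideriv2_bound:
  assumes "locint f" "\<And>x. \<bar>f x\<bar> \<le> C" "\<bar>y\<bar> \<le> pi / 2"
  shows "\<bar>antideriv2 f y\<bar> \<le> C * pi\<^sup>2"
proof -
  have C: "0 \<le> C" using assms(2)[of 0] by linarith
  have "\<bar>antideriv2 f y\<bar> \<le> (C * pi) * \<bar>y - 0\<bar>"
    unfolding antideriv2_def
  proof (rule ibint_bound[OF locint_continuous[OF antideriv1_continuous[OF assms(1,2)]]])
    fix x assume "min 0 y \<le> x" "x \<le> max 0 y"
    then have x: "\<bar>x - pi/2\<bar> \<le> pi" using assms(3) pi_gt_zero by linarith
    have "\<bar>antideriv1 f x\<bar> \<le> C * \<bar>x - pi/2\<bar>"
      unfolding antideriv1_def by (rule ibint_bound[OF assms(1,2)])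
    also have "\<dots> \<le> C * pi" using x C by (rule mult_left_mono)
    finally show "\<bar>antideriv1 f x\<bar> \<le> C * pi" .
  qed
  also have "\<dots> \<le> (C * pi) * pi"
    using assms(3) C pi_gt_zero by (intro mult_left_mono) auto
  finally show ?thesis by (simp add: power2_eq_square)
qed

text \<open>The reflection x to pi - x exchanges [-pi/2, pi/2] with the other half of the circle, so
  mean zero over one half already gives mean zero over the whole.\<close>

locale symmetric_source =
  fixes f :: "real \<Rightarrow> real" and C :: real
  assumes int: "locint f" and bd: "\<And>x. \<bar>f x\<bar> \<le> C"
    and sym: "\<And>x. f (pi - x) = f x" and per: "\<And>x. f (x + 2 * pi) = f x"
    and mean: "ibint (- (pi / 2)) (pi / 2) f = 0"
begin

lemma antideriv1_reflect: "antideriv1 f (pi - x) = - antideriv1 f x"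
  using ibint_reflect_about[of x "pi/2" f pi] ibint_swap[of x "pi/2" f]
  by (simp add: antideriv1_def sym)

text \<open>Mean zero passes from [-pi/2, pi/2] to [pi/2, 3pi/2] by reflection and to [3pi/2, 5pi/2]
  by translation, so the full period [pi/2, 5pi/2] contributes nothing.\<close>

lemma antideriv1_periodic: "antideriv1 f (x + 2 * pi) = antideriv1 f x"
proof -
  have "ibint (3*pi/2) (5*pi/2) f = 0"
    using ibint_shift[of "-(pi/2)" "pi/2" f "2*pi"] by (simp add: per mean)
  moreover have "ibint (pi/2) (3*pi/2) f = 0"
    using ibint_reflect_about[of "-(pi/2)" "pi/2" f pi] by (simp add: sym mean)
  ultimately have "ibint (pi/2) (5*pi/2) f = 0"
    using ibint_concat[OF int, of "pi/2" "3*pi/2" "5*pi/2"] by simp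
  moreover have "ibint (5*pi/2) (x + 2*pi) f = ibint (pi/2) x f"
    using ibint_shift[of "pi/2" x f "2*pi"] by (simp add: per)
  ultimately show ?thesis
    using ibint_concat[OF int, of "pi/2" "5*pi/2" "x+2*pi"] by (simp add: antideriv1_def)
qed

lemma locint_antideriv1: "locint (antideriv1 f)"
  by (rule locint_continuous[OF antideriv1_continuous[OF int bd]])

lemma antideriv2_reflect: "antideriv2 f (pi - x) = antideriv2 f x"
proof -
  have r: "ibint a b (antideriv1 f) = - ibint (pi - b) (pi - a) (antideriv1 f)" for a b
    using ibint_reflect_about[of a b "antideriv1 f" pi] ibint_cmult[of a b "-1" "antideriv1 f"]
    by (simp add: antideriv1_reflect)
  \<comment> \<open>Oddness about pi/2 cancels the integral over [0, pi]; this is the source of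
    phi(0) = phi(pi).\<close>
  have "ibint 0 pi (antideriv1 f) = 0" using r[of 0 pi] by simp
  moreover have "ibint pi (pi - x) (antideriv1 f) = ibint 0 x (antideriv1 f)"
    using r[of 0 x] ibint_swap[of pi "pi - x"] by simp
  ultimately show ?thesis
    using ibint_concat[OF locint_antideriv1, of 0 pi "pi - x"] by (simp add: antideriv2_def)
qed

lemma antideriv2_periodic: "antideriv2 f (x + 2 * pi) = antideriv2 f x"
proof -
  have r: "ibint a b (antideriv1 f) = - ibint (pi - b) (pi - a) (antideriv1 f)" for a b
    using ibint_reflect_about[of a b "antideriv1 f" pi] ibint_cmult[of a b "-1" "antideriv1 f"]
    by (simp add: antideriv1_reflect)
  have s: "ibint a b (antideriv1 f) = ibint (a + 2*pi) (b + 2*pi) (antideriv1 f)" for a b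
    using ibint_shift[of a b "antideriv1 f" "2*pi"] by (simp add: antideriv1_periodic)
  have "ibint 0 pi (antideriv1 f) = 0" using r[of 0 pi] by simp
  \<comment> \<open>Reflection carries [-pi, 0] to [pi, 2 pi] with a sign, translation does so
    without one, so the integral equals its own negative.\<close>
  moreover have "ibint pi (2*pi) (antideriv1 f) = 0" using r[of "-pi" 0] s[of "-pi" 0] by simp
  ultimately have "ibint 0 (2*pi) (antideriv1 f) = 0"
    using ibint_concat[OF locint_antideriv1, of 0 pi "2*pi"] by simp
  then show ?thesis
    using ibint_concat[OF locint_antideriv1, of 0 "2*pi" "x+2*pi"] s[of 0 x] by (simp add: antideriv2_def)
qed

text \<open>Points with equal sine are related by periods and the reflection in pi/2, and
  \<open>antideriv2 f\<close> is invariant under both. This later removes the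
  \<open>arcsin (sin x)\<close> built into the fixed point map.\<close>

lemma antideriv2_arcsin_sin: "antideriv2 f (arcsin (sin x)) = antideriv2 f x"
proof -
  interpret H: periodic_fun_simple "antideriv2 f" "2 * pi"
    by standard (rule antideriv2_periodic)
  have "sin x = sin (arcsin (sin x))" by simp
  then obtain k :: int where "x = arcsin (sin x) + 2 * of_int k * pi \<or> x = - arcsin (sin x) + (2 * of_int k + 1) * pi"
    unfolding sin_eq by (metis Ints_cases)
  then show ?thesis
  proof
    assume "x = arcsin (sin x) + 2 * of_int k * pi"
    then show ?thesis using H.plus_of_int[of "arcsin (sin x)" k] by (simp add: mult_ac)
  next
    assume "x = - arcsin (sin x) + (2 * of_int k + 1) * pi"
    then have "x = (pi - arcsin (sin x)) + of_int k * (2 * pi)" by (simp add: algebra_simps)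
    then show ?thesis using H.plus_of_int[of "pi - arcsin (sin x)" k] antideriv2_reflect by simp
  qed
qed

end

text \<open>Composing with \<open>arcsin (sin x)\<close> makes every image symmetric, periodic and
  bounded without requiring the source of a general u to be symmetric or of mean zero. A contraction
  on a ball of bounded continuous functions then suffices, with a threshold uniform in the
  index.\<close>

lemma antideriv2_fixed_point:
  fixes \<Phi> :: "'i \<Rightarrow> (real \<Rightarrow>\<^sub>C real) \<Rightarrow> real \<Rightarrow> real" and c :: "real \<Rightarrow>\<^sub>C real"
  defines "c \<equiv> const_bcontfun 1"
  assumes "r > 0"
    and BL: "BL (I \<times> UNIV) (cball c r) (\<lambda>(i, x) u. \<Phi> i u x)"
    and int: "\<And>i u. i \<in> I \<Longrightarrow> u \<in> cball c r \<Longrightarrow> locint (\<Phi> i u)"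
  shows "\<exists>\<epsilon>>0. \<forall>\<delta> i. \<bar>\<delta>\<bar> \<le> \<epsilon> \<and> i \<in> I \<longrightarrow>
    (\<exists>u\<in>cball c r. \<forall>x. apply_bcontfun u x = 1 + \<delta> * antideriv2 (\<Phi> i u) (arcsin (sin x)))"
proof -
  obtain M where M: "M \<ge> 0" "\<And>i u. i \<in> I \<times> UNIV \<Longrightarrow> u \<in> cball c r \<Longrightarrow> \<bar>(\<lambda>(i, x) u. \<Phi> i u x) i u\<bar> \<le> M"
    "\<And>i u v. i \<in> I \<times> UNIV \<Longrightarrow> u \<in> cball c r \<Longrightarrow> v \<in> cball c r \<Longrightarrow>
       \<bar>(\<lambda>(i, x) u. \<Phi> i u x) i u - (\<lambda>(i, x) u. \<Phi> i u x) i v\<bar> \<le> M * dist u v"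
    using BL by (rule BL_E) blast
  have M2: "\<bar>\<Phi> i u x\<bar> \<le> M" if "i \<in> I" "u \<in> cball c r" for i u x
    using M(2)[of "(i, x)" u] that by simp
  have M3: "\<bar>\<Phi> i u x - \<Phi> i v x\<bar> \<le> M * dist u v" if "i \<in> I" "u \<in> cball c r" "v \<in> cball c r" for i u v x
    using M(3)[of "(i, x)" u v] that by simp
  define R where "R = M * pi\<^sup>2 + 1"
  have R: "R > 0" "M * pi\<^sup>2 \<le> R" using M(1) by (auto simp: R_def add_nonneg_pos)
  \<comment> \<open>The bound r on epsilon R keeps the ball invariant, the bound 1/2 gives the
    contraction factor; the summand 1 in R excludes division by zero when M = 0.\<close>
  define \<epsilon> where "\<epsilon> = min r (1/2) / R"
  have eps: "\<epsilon> > 0" "\<epsilon> * R \<le> r" "\<epsilon> * R \<le> 1/2" using R \<open>r > 0\<close> by (auto simp: \<epsilon>_def)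
  have arc: "\<bar>arcsin (sin x)\<bar> \<le> pi / 2" for x :: real
    using arcsin_bounded[OF sin_ge_minus_one[of x] sin_le_one[of x]] by linarith
  have "\<exists>u\<in>cball c r. \<forall>x. apply_bcontfun u x = 1 + \<delta> * antideriv2 (\<Phi> i u) (arcsin (sin x))"
    if \<delta>: "\<bar>\<delta>\<bar> \<le> \<epsilon>" and i: "i \<in> I" for \<delta> i
  proof -
    define T where "T u = Bcontfun (\<lambda>x. 1 + \<delta> * antideriv2 (\<Phi> i u) (arcsin (sin x)))" for u
    have T: "apply_bcontfun (T u) x = 1 + \<delta> * antideriv2 (\<Phi> i u) (arcsin (sin x))" if u: "u \<in> cball c r" for u x
    proof -
      have "(\<lambda>x. 1 + \<delta> * antideriv2 (\<Phi> i u) (arcsin (sin x))) \<in> bcontfun"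
      proof (rule bcontfun_normI[where b = "1 + \<bar>\<delta>\<bar> * (M * pi\<^sup>2)"])
        have "continuous_on UNIV (antideriv2 (\<Phi> i u))"
          using antideriv2_has_derivative[OF int[OF i u] M2[OF i u]]
          by (meson DERIV_isCont continuous_at_imp_continuous_on)
        moreover have "continuous_on UNIV (\<lambda>x::real. arcsin (sin x))"
          by (rule continuous_on_arcsin) (simp_all add: continuous_on_sin)
        ultimately have "continuous_on UNIV (\<lambda>x. antideriv2 (\<Phi> i u) (arcsin (sin x)))"
          by (rule continuous_on_compose2) simp
        then show "continuous_on UNIV (\<lambda>x. 1 + \<delta> * antideriv2 (\<Phi> i u) (arcsin (sin x)))"
          by (rule continuous_on_add[OF continuous_on_const continuous_on_mult_left])
        show "norm (1 + \<delta> * antideriv2 (\<Phi> i u) (arcsin (sin x))) \<le> 1 + \<bar>\<delta>\<bar> * (M * pi\<^sup>2)" for x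
        proof -
          have "\<bar>\<delta> * antideriv2 (\<Phi> i u) (arcsin (sin x))\<bar> \<le> \<bar>\<delta>\<bar> * (M * pi\<^sup>2)"
            unfolding abs_mult
            by (rule mult_left_mono[OF antideriv2_bound[OF int[OF i u] M2[OF i u] arc] abs_ge_zero])
          then show ?thesis
            using abs_triangle_ineq[of 1 "\<delta> * antideriv2 (\<Phi> i u) (arcsin (sin x))"] by simp
        qed
      qed
      then show ?thesis by (simp add: T_def Bcontfun_inverse)
    qed
    have "\<exists>!u\<in>cball c r. T u = u"
    proof (rule Banach_fix[where c = "1/2"])
      show "complete (cball c r)" by (simp add: complete_eq_closed)
      show "cball c r \<noteq> {}" using \<open>r > 0\<close> by simp
      show "T ` cball c r \<subseteq> cball c r"
      proof safe
        fix u assume u: "u \<in> cball c r"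
        have "dist (T u) c \<le> r"
        proof (rule dist_bound)
          fix x
          have "\<bar>\<delta> * antideriv2 (\<Phi> i u) (arcsin (sin x))\<bar> \<le> \<epsilon> * R"
            unfolding abs_mult using \<delta> R eps antideriv2_bound[OF int[OF i u] M2[OF i u] arc[of x]]
            by (intro mult_mono) auto
          then show "dist (apply_bcontfun (T u) x) (apply_bcontfun c x) \<le> r"
            using eps by (simp add: T[OF u] c_def dist_real_def)
        qed
        then show "T u \<in> cball c r" by (simp add: dist_commute)
      qed
      show "dist (T u) (T v) \<le> 1/2 * dist u v" if u: "u \<in> cball c r" and v: "v \<in> cball c r" for u v
      proof (rule dist_bound)
        fix x
        have "\<bar>antideriv2 (\<lambda>x. \<Phi> i u x - \<Phi> i v x) (arcsin (sin x))\<bar> \<le> (M * dist u v) * pi\<^sup>2"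
          by (rule antideriv2_bound[OF locint_diff[OF int[OF i u] int[OF i v]] M3[OF i u v] arc])
        also have "\<dots> \<le> R * dist u v"
          using R(2) mult_right_mono[OF R(2), of "dist u v"] by (simp add: mult_ac)
        finally have *: "\<bar>antideriv2 (\<Phi> i u) (arcsin (sin x)) - antideriv2 (\<Phi> i v) (arcsin (sin x))\<bar> \<le> R * dist u v"
          using antideriv2_diff[OF int[OF i u] M2[OF i u] int[OF i v] M2[OF i v]] by simp
        have "dist (apply_bcontfun (T u) x) (apply_bcontfun (T v) x) = \<bar>\<delta>\<bar> * \<bar>antideriv2 (\<Phi> i u) (arcsin (sin x)) - antideriv2 (\<Phi> i v) (arcsin (sin x))\<bar>"
          unfolding T[OF u] T[OF v] dist_real_def abs_mult[symmetric] by (simp add: right_diff_distrib)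
        also have "\<dots> \<le> \<epsilon> * (R * dist u v)"
          using \<delta> * eps R by (intro mult_mono) auto
        also have "\<dots> \<le> 1/2 * dist u v"
          using mult_right_mono[OF eps(3), of "dist u v"] by (simp add: mult_ac)
        finally show "dist (apply_bcontfun (T u) x) (apply_bcontfun (T v) x) \<le> 1/2 * dist u v" .
      qed
    qed auto
    then obtain u where "u \<in> cball c r" "T u = u" by blast
    then show ?thesis using T by metis
  qed
  then show ?thesis using eps(1) by blast
qed

section \<open>The rescaled system\<close>

lemma lam_measurable [measurable]: "lam \<in> borel_measurable borel"
  unfolding lam_def[abs_def] sgn_if by measurable

lemma abs_lam_le: "\<bar>lam x\<bar> \<le> 1"
  by (simp add: lam_def sgn_if)

lemma lam_reflect: "lam (pi - x) = lam x"
  by (simp add: lam_def)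

lemma lam_periodic: "lam (x + 2 * pi) = lam x"
  by (simp add: lam_def)

lemma lam_uminus: "lam (- x) = - lam x"
  by (simp add: lam_def sgn_minus)

lemma locint_lam: "locint lam"
  using abs_lam_le by (intro locint_bounded[where C = "\<lambda>_ _. 1"]) auto

lemma ibint_lam_odd: "ibint (- a) a lam = 0"
  using ibint_reflect[of "-a" a lam] ibint_cmult[of "-a" a "-1" lam] by (simp add: lam_uminus)

abbreviation mid_int :: "(real \<Rightarrow> real) \<Rightarrow> real" where
  "mid_int f \<equiv> ibint (- (pi / 2)) (pi / 2) f"

abbreviation unit_fn :: "real \<Rightarrow>\<^sub>C real" where
  "unit_fn \<equiv> const_bcontfun 1"

text \<open>A radius of at most 1/2 keeps u away from zero, where its negative powers are
  singular.\<close>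

lemma cball_unit_fn:
  assumes "u \<in> cball unit_fn r" "r \<le> 1 / 2"
  shows "1 / 2 \<le> apply_bcontfun u x" "apply_bcontfun u x \<le> 3 / 2"
proof -
  have "dist (apply_bcontfun u x) 1 \<le> r"
    using assms(1) dist_bounded[of u x unit_fn] by (simp add: dist_commute)
  then show "1 / 2 \<le> apply_bcontfun u x" "apply_bcontfun u x \<le> 3 / 2"
    using assms(2) by (auto simp: dist_real_def abs_le_iff)
qed

text \<open>\<open>\<alpha>\<close> is \<open>\<mu>\<close> divided by \<open>sqrt (\<kappa> \<mu>^2 + 2 \<eta>^2)\<close>, and \<open>data_ratio \<alpha> u\<close> is the latter
  square root divided by \<open>\<phi>(0)^q\<close>; it is chosen to be the positive root of the quadratic equation
  saying that the source has mean zero.\<close>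

locale rescaled_system =
  fixes \<kappa> q t \<gamma> :: real
  assumes kappa: "\<kappa> > 0" and q: "q > 2" and t: "\<bar>t\<bar> > \<bar>\<gamma>\<bar>"
begin

text \<open>The values of alpha = mu / M allowed by M^2 = kappa mu^2 + 2 eta^2. They need not
  converge as (mu, eta) tends to zero, hence the insistence on estimates uniform over this
  set.\<close>

definition dirs :: "real set" where
  "dirs = {\<alpha>. \<kappa> * \<alpha>\<^sup>2 \<le> 1}"

text \<open>Integrating the bracket in \<open>source\<close> over half the circle gives A - B y - C
  y^2; \<open>coefA\<close>, \<open>coefB\<close> and \<open>coefC\<close> collect the powers of
  y.\<close>

definition coefA :: "(real \<Rightarrow>\<^sub>C real) \<Rightarrow> real" where
  "coefA u = mid_int (\<lambda>x. \<kappa> * (t + lam x)\<^sup>2 * u x powr (q - 1) - \<kappa> * (lam x + \<gamma>)\<^sup>2 * u x powr (- q - 1))"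

definition coefB :: "real \<Rightarrow> (real \<Rightarrow>\<^sub>C real) \<Rightarrow> real" where
  "coefB \<alpha> u = 2 * \<kappa> * \<alpha> * mid_int (\<lambda>x. (lam x + \<gamma>) * u x powr (- q - 1))"

definition coefC :: "(real \<Rightarrow>\<^sub>C real) \<Rightarrow> real" where
  "coefC u = mid_int (\<lambda>x. u x powr (- q - 1))"

definition data_ratio :: "real \<Rightarrow> (real \<Rightarrow>\<^sub>C real) \<Rightarrow> real" where
  "data_ratio \<alpha> u = (sqrt ((coefB \<alpha> u)\<^sup>2 + 4 * coefA u * coefC u) - coefB \<alpha> u) / (2 * coefC u)"

text \<open>The leading factor comes from D / d^2 = D^(1 - 2/q) with D = M / y: the power of M is
  absorbed into delta, the power of y stays here.\<close>

definition source :: "real \<Rightarrow> (real \<Rightarrow>\<^sub>C real) \<Rightarrow> real \<Rightarrow> real" where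
  "source \<alpha> u x = data_ratio \<alpha> u powr (2 / q - 1) *
     (\<kappa> * (t + lam x)\<^sup>2 * u x powr (q - 1)
      - ((data_ratio \<alpha> u)\<^sup>2 + 2 * \<kappa> * \<alpha> * data_ratio \<alpha> u * (lam x + \<gamma>) + \<kappa> * (lam x + \<gamma>)\<^sup>2) * u x powr (- q - 1))"

abbreviation "half_ball \<equiv> cball unit_fn (1 / 2)"

section \<open>Uniform estimates for the coefficients and the positive root\<close>

lemma dirs_bound: "\<alpha> \<in> dirs \<Longrightarrow> \<bar>\<alpha>\<bar> \<le> sqrt (1 / \<kappa>)"
  using kappa by (intro real_le_rsqrt) (simp add: dirs_def field_simps)

lemma BL_eval: "BL I half_ball (\<lambda>(i :: 'i) u. apply_bcontfun u (h i))"
proof (rule BL_I[where B = "3/2" and L = 1])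
  show "\<bar>apply_bcontfun u (h i)\<bar> \<le> 3 / 2" if "u \<in> half_ball" for u i
    using cball_unit_fn[OF that, of "h i"] by simp
  show "\<bar>apply_bcontfun u (h i) - apply_bcontfun v (h i)\<bar> \<le> 1 * dist u v" for u v i
    using dist_bounded[of u "h i" v] by (simp add: dist_real_def)
qed

lemma BL_eval_powr: "BL I half_ball (\<lambda>i u. apply_bcontfun u (h i) powr s)"
  using cball_unit_fn(1) by (intro BL_powr[OF BL_eval, where c = "1/2"]) auto

lemma BL_lam: "BL I X (\<lambda>i u. lam (h i) + c)"
  by (intro BL_add BL_const[where C = 1] BL_const[where C = "\<bar>c\<bar>"] abs_lam_le order_refl)

lemma BL_eval_terms:
  "BL I half_ball (\<lambda>i u. apply_bcontfun u (h i) powr s)"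
  "BL I half_ball (\<lambda>i u. (lam (h i) + c) * apply_bcontfun u (h i) powr s)"
  "BL I half_ball (\<lambda>i u. \<kappa> * (lam (h i) + c)\<^sup>2 * apply_bcontfun u (h i) powr s)"
  unfolding power2_eq_square
  by (intro BL_mult BL_cmult BL_eval_powr BL_lam)+

lemma locint_eval_terms:
  fixes u :: "real \<Rightarrow>\<^sub>C real"
  assumes "u \<in> half_ball"
  shows "locint (\<lambda>x. u x powr s)" "locint (\<lambda>x. (lam x + c) * u x powr s)"
    "locint (\<lambda>x. \<kappa> * (lam x + c)\<^sup>2 * u x powr s)"
proof -
  have [measurable]: "apply_bcontfun u \<in> borel_measurable borel"
    by (intro borel_measurable_continuous_onI) simp
  have *: "locint f" if f: "f \<in> borel_measurable borel" and F: "BL UNIV half_ball F" "\<And>x. F x u = f x"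
    for f and F :: "real \<Rightarrow> (real \<Rightarrow>\<^sub>C real) \<Rightarrow> real"
  proof -
    obtain C where "\<And>x. \<bar>F x u\<bar> \<le> C"
      by (rule BL_E[OF F(1)]) (use assms in blast)
    then show ?thesis
      using F(2) by (intro locint_bounded[OF f, where C = "\<lambda>_ _. C"]) simp
  qed
  show "locint (\<lambda>x. u x powr s)"
    by (rule *[OF _ BL_eval_terms(1)[of UNIV id s]]) auto
  show "locint (\<lambda>x. (lam x + c) * u x powr s)"
    by (rule *[OF _ BL_eval_terms(2)[of UNIV id c s]]) auto
  show "locint (\<lambda>x. \<kappa> * (lam x + c)\<^sup>2 * u x powr s)"
    by (rule *[OF _ BL_eval_terms(3)[of UNIV id c s]]) auto
qed

lemma BL_coefA: "BL dirs half_ball (\<lambda>\<alpha> u. coefA u)"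
proof -
  have "BL dirs half_ball (\<lambda>\<alpha> u. mid_int (\<lambda>x. \<kappa> * (lam x + t)\<^sup>2 * u x powr (q - 1) - \<kappa> * (lam x + \<gamma>)\<^sup>2 * u x powr (- q - 1)))"
    by (intro BL_ibint locint_diff locint_eval_terms)
      (auto simp: case_prod_unfold intro!: BL_diff BL_eval_terms)
  then show ?thesis by (simp add: coefA_def add.commute)
qed

lemma BL_coefB: "BL dirs half_ball coefB"
proof -
  have "BL dirs half_ball (\<lambda>\<alpha> u. mid_int (\<lambda>x. (lam x + \<gamma>) * u x powr (- q - 1)))"
    by (intro BL_ibint locint_eval_terms) (auto simp: case_prod_unfold intro!: BL_eval_terms)
  then show ?thesis
    unfolding coefB_def[abs_def]
    by (intro BL_mult BL_const[OF dirs_bound] BL_const[where C = "\<bar>2 * \<kappa>\<bar>"]) (auto simp: mult.assoc intro!: BL_const[where C = "\<bar>2 * \<kappa>\<bar>"])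
qed

lemma BL_coefC: "BL dirs half_ball (\<lambda>\<alpha> u. coefC u)"
  unfolding coefC_def
  by (intro BL_ibint locint_eval_terms) (auto simp: case_prod_unfold intro!: BL_eval_terms)

lemma coefC_lower:
  assumes "u \<in> half_ball"
  shows "(3 / 2) powr (- q - 1) * pi \<le> coefC u"
proof -
  have "mid_int (\<lambda>x. (3 / 2) powr (- q - 1)) \<le> coefC u"
    unfolding coefC_def
    using cball_unit_fn[OF assms] q
    by (intro ibint_mono locint_continuous locint_eval_terms assms powr_mono2')
      (auto intro: less_le_trans[of 0 "1/2"])
  then show ?thesis by (simp add: ibint_const)
qed

text \<open>At u = 1 the lambda^2 terms cancel, leaving a constant plus a multiple of the odd
  function \<open>lam\<close>. The assumption |t| > |gamma| makes the result positive.\<close>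

lemma coefA_unit: "coefA unit_fn = \<kappa> * (t\<^sup>2 - \<gamma>\<^sup>2) * pi"
proof -
  have "coefA unit_fn = mid_int (\<lambda>x. \<kappa> * (t\<^sup>2 - \<gamma>\<^sup>2) + 2 * \<kappa> * (t - \<gamma>) * lam x)"
    unfolding coefA_def by (rule ibint_cong) (simp add: power2_eq_square algebra_simps)
  also have "\<dots> = \<kappa> * (t\<^sup>2 - \<gamma>\<^sup>2) * pi"
    by (simp add: ibint_add ibint_cmult ibint_const ibint_lam_odd locint_cmult locint_lam locint_continuous)
  finally show ?thesis .
qed

lemma t_gt: "\<gamma>\<^sup>2 < t\<^sup>2"
  using t power_strict_mono[of "\<bar>\<gamma>\<bar>" "\<bar>t\<bar>" 2] by simp

lemma coefA_lower:
  obtains r c where "0 < r" "r \<le> 1 / 2" "c > 0" "\<And>u. u \<in> cball unit_fn r \<Longrightarrow> c \<le> coefA u"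
proof -
  obtain C where C: "C \<ge> 0" "\<And>i u. i \<in> dirs \<Longrightarrow> u \<in> half_ball \<Longrightarrow> \<bar>coefA u\<bar> \<le> C"
    "\<And>i u v. i \<in> dirs \<Longrightarrow> u \<in> half_ball \<Longrightarrow> v \<in> half_ball \<Longrightarrow> \<bar>coefA u - coefA v\<bar> \<le> C * dist u v"
    using BL_coefA by (rule BL_E) blast
  have d: "0 \<in> dirs" by (simp add: dirs_def)
  define c where "c = coefA unit_fn / 2"
  have "c > 0" using kappa t_gt by (simp add: c_def coefA_unit)
  \<comment> \<open>Moving a distance r away from 1 changes \<open>coefA\<close> by at most C r,
    which is at most c, half of its value at 1.\<close>
  define r where "r = min (1/2) (c / (C + 1))"
  have r: "0 < r" "r \<le> 1/2" "C * r \<le> c"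
  proof -
    show "0 < r" using \<open>c > 0\<close> C(1) by (simp add: r_def)
    show "r \<le> 1/2" unfolding r_def by (rule min.cobounded1)
    have "C * r \<le> (C + 1) * (c / (C + 1))"
      using C(1) \<open>c > 0\<close> by (intro mult_mono) (auto simp: r_def)
    then show "C * r \<le> c" using C(1) by simp
  qed
  show thesis
  proof (rule that[OF r(1,2) \<open>c > 0\<close>])
    fix u assume u: "u \<in> cball unit_fn r"
    then have "\<bar>coefA unit_fn - coefA u\<bar> \<le> C * dist unit_fn u"
      using r(2) by (intro C(3)[OF d]) auto
    also have "\<dots> \<le> C * r" using u C(1) by (intro mult_left_mono) auto
    finally show "c \<le> coefA u" using r(3) by (simp add: c_def)
  qed
qed

text \<open>Since A and C are positive, the root of the discriminant exceeds |B|, so this solution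
  is positive whatever the sign of B.\<close>

lemma data_ratio_root:
  assumes "u \<in> half_ball" "coefA u > 0"
  shows "coefA u - coefB \<alpha> u * data_ratio \<alpha> u - coefC u * (data_ratio \<alpha> u)\<^sup>2 = 0" "data_ratio \<alpha> u > 0"
proof -
  have C: "coefC u > 0"
    using coefC_lower[OF assms(1)] by (rule less_le_trans[rotated]) simp
  define s where "s = sqrt ((coefB \<alpha> u)\<^sup>2 + 4 * coefA u * coefC u)"
  have s2: "s\<^sup>2 = (coefB \<alpha> u)\<^sup>2 + 4 * coefA u * coefC u"
    using assms(2) C by (simp add: s_def)
  have "s > coefB \<alpha> u"
  proof -
    have "(coefB \<alpha> u)\<^sup>2 < (coefB \<alpha> u)\<^sup>2 + 4 * coefA u * coefC u"
      using assms(2) C by simp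
    then have "sqrt ((coefB \<alpha> u)\<^sup>2) < s" unfolding s_def by (rule real_sqrt_less_mono)
    then show ?thesis by simp
  qed
  have sc: "data_ratio \<alpha> u = (s - coefB \<alpha> u) / (2 * coefC u)" by (simp add: data_ratio_def s_def)
  then show "data_ratio \<alpha> u > 0" using \<open>s > coefB \<alpha> u\<close> C by simp
  have *: "s = 2 * coefC u * data_ratio \<alpha> u + coefB \<alpha> u" using C by (simp add: sc)
  have "4 * coefC u * (coefA u - coefB \<alpha> u * data_ratio \<alpha> u - coefC u * (data_ratio \<alpha> u)\<^sup>2) = 0"
    using s2 unfolding * by (simp add: power2_eq_square algebra_simps)
  then show "coefA u - coefB \<alpha> u * data_ratio \<alpha> u - coefC u * (data_ratio \<alpha> u)\<^sup>2 = 0"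
    using C by simp
qed

text \<open>The discriminant and C are bounded below, so the root formula falls under
  \<open>BL_powr\<close>. The lower bound on y is needed because y enters the source with the
  negative exponent 2/q - 1.\<close>

lemma BL_data_ratio:
  assumes "r \<le> 1 / 2" "c > 0" "\<And>u. u \<in> cball unit_fn r \<Longrightarrow> c \<le> coefA u"
  shows "BL dirs (cball unit_fn r) data_ratio"
    and "\<exists>m>0. \<forall>\<alpha>\<in>dirs. \<forall>u\<in>cball unit_fn r. m \<le> data_ratio \<alpha> u"
proof -
  have sub: "cball unit_fn r \<subseteq> half_ball" using assms(1) by auto
  define k where "k = (3 / 2) powr (- q - 1) * pi"
  have k: "k > 0" by (simp add: k_def)
  have Ck: "k \<le> coefC u" if "u \<in> cball unit_fn r" for u
    using coefC_lower sub that by (auto simp: k_def)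
  have ck: "c * k \<le> coefA u * coefC u" if "u \<in> cball unit_fn r" for u
    using assms(2) assms(3)[OF that] Ck[OF that] k by (intro mult_mono) auto
  note BLA = BL_subset[OF BL_coefA sub] and BLB = BL_subset[OF BL_coefB sub] and BLC = BL_subset[OF BL_coefC sub]
  define disc where "disc \<alpha> u = (coefB \<alpha> u)\<^sup>2 + 4 * (coefA u * coefC u)" for \<alpha> u
  have dge: "4 * (c * k) \<le> disc \<alpha> u" if "u \<in> cball unit_fn r" for \<alpha> u
    unfolding disc_def using ck[OF that] zero_le_power2[of "coefB \<alpha> u"] by linarith
  have BLs: "BL dirs (cball unit_fn r) (\<lambda>\<alpha> u. disc \<alpha> u powr (1/2))"
    using dge assms(2) k unfolding disc_def[abs_def] power2_eq_square
    by (intro BL_powr[where c = "4 * (c * k)"] BL_add BL_mult BL_cmult BLA BLB BLC) (auto simp: disc_def power2_eq_square)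
  have eq: "disc \<alpha> u powr (1/2) = sqrt ((coefB \<alpha> u)\<^sup>2 + 4 * coefA u * coefC u)" if "u \<in> cball unit_fn r" for \<alpha> u
    using order_trans[OF _ dge[OF that, of \<alpha>], of 0] mult_pos_pos[OF assms(2) k]
    by (subst powr_half_sqrt) (auto simp: disc_def)
  have "BL dirs (cball unit_fn r) (\<lambda>\<alpha> u. (disc \<alpha> u powr (1/2) - coefB \<alpha> u) * (2 * coefC u) powr (- 1))"
  proof (intro BL_mult BL_diff BLs BLB BL_powr[where c = "2 * k"] BL_cmult BLC)
  qed (use k Ck in \<open>auto intro: BL_const[where C = 2]\<close>)
  then show "BL dirs (cball unit_fn r) data_ratio"
  proof (rule BL_cong)
    fix \<alpha> u assume "\<alpha> \<in> dirs" and u: "u \<in> cball unit_fn r"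
    have "(2 * coefC u) powr (- 1) = 1 / (2 * coefC u)"
      using Ck[OF u] k by (simp add: powr_minus_divide)
    then show "(disc \<alpha> u powr (1/2) - coefB \<alpha> u) * (2 * coefC u) powr (- 1) = data_ratio \<alpha> u"
      unfolding eq[OF u] data_ratio_def by simp
  qed
  obtain B where B: "B \<ge> 0" "\<And>i u. i \<in> dirs \<Longrightarrow> u \<in> cball unit_fn r \<Longrightarrow> \<bar>coefB i u\<bar> \<le> B"
    using BLB by (rule BL_E) blast
  obtain C where C: "C \<ge> 0" "\<And>i u. i \<in> dirs \<Longrightarrow> u \<in> cball unit_fn r \<Longrightarrow> \<bar>coefC u\<bar> \<le> C"
    using BLC by (rule BL_E) blast
  obtain Y where Y: "Y \<ge> 0" "\<And>i u. i \<in> dirs \<Longrightarrow> u \<in> cball unit_fn r \<Longrightarrow> \<bar>data_ratio i u\<bar> \<le> Y"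
    using \<open>BL dirs (cball unit_fn r) data_ratio\<close> by (rule BL_E) blast
  \<comment> \<open>With B, C, Y now the uniform bounds, the quadratic equation gives c <= (B + C Y
    + 1) y; the summand 1 keeps the denominator positive.\<close>
  define m where "m = c / (B + C * Y + 1)"
  have "m > 0" using B(1) C(1) Y(1) assms(2) by (auto simp: m_def intro!: divide_pos_pos add_nonneg_pos)
  moreover have "m \<le> data_ratio \<alpha> u" if a: "\<alpha> \<in> dirs" "u \<in> cball unit_fn r" for \<alpha> u
  proof -
    have pos: "coefA u > 0" "u \<in> half_ball" using assms(2) assms(3)[OF a(2)] sub a(2) by auto
    have y: "data_ratio \<alpha> u > 0" by (rule data_ratio_root[OF pos(2,1)])
    have "c \<le> coefB \<alpha> u * data_ratio \<alpha> u + coefC u * (data_ratio \<alpha> u)\<^sup>2"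
      using data_ratio_root(1)[OF pos(2,1), of \<alpha>] assms(3)[OF a(2)] by linarith
    also have "\<dots> = (coefB \<alpha> u + coefC u * data_ratio \<alpha> u) * data_ratio \<alpha> u"
      by (simp add: power2_eq_square algebra_simps)
    also have "\<dots> \<le> (B + C * Y + 1) * data_ratio \<alpha> u"
    proof (rule mult_right_mono)
      have "coefC u * data_ratio \<alpha> u \<le> C * Y"
        using C(1) C(2)[OF a] Y(2)[OF a] y by (intro mult_mono) auto
      then show "coefB \<alpha> u + coefC u * data_ratio \<alpha> u \<le> B + C * Y + 1"
        using B(2)[OF a] by linarith
    qed (use y in simp)
    finally show ?thesis
      using B(1) C(1) Y(1) by (simp add: m_def divide_le_eq mult.commute add_nonneg_pos)
  qed
  ultimately show "\<exists>m>0. \<forall>\<alpha>\<in>dirs. \<forall>u\<in>cball unit_fn r. m \<le> data_ratio \<alpha> u" by blast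
qed

section \<open>The source term and the fixed point\<close>

lemma locint_source:
  assumes "u \<in> half_ball"
  shows "locint (source \<alpha> u)"
proof -
  define y where "y = data_ratio \<alpha> u"
  have "locint (\<lambda>x. y powr (2/q - 1) * (\<kappa> * (lam x + t)\<^sup>2 * u x powr (q - 1)
      - (y\<^sup>2 * u x powr (- q - 1) + 2 * \<kappa> * \<alpha> * y * ((lam x + \<gamma>) * u x powr (- q - 1))
         + \<kappa> * (lam x + \<gamma>)\<^sup>2 * u x powr (- q - 1))))"
    by (intro locint_cmult locint_diff locint_add locint_eval_terms assms)
  also have "(\<lambda>x. y powr (2/q - 1) * (\<kappa> * (lam x + t)\<^sup>2 * u x powr (q - 1)
      - (y\<^sup>2 * u x powr (- q - 1) + 2 * \<kappa> * \<alpha> * y * ((lam x + \<gamma>) * u x powr (- q - 1))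
         + \<kappa> * (lam x + \<gamma>)\<^sup>2 * u x powr (- q - 1)))) = source \<alpha> u"
    by (simp add: fun_eq_iff source_def y_def algebra_simps)
  finally show ?thesis .
qed

text \<open>Up to a power of y the mean is A - B y - C y^2, which vanishes since y was chosen as a
  root.\<close>

lemma source_mean:
  assumes "u \<in> half_ball" "coefA u > 0"
  shows "mid_int (source \<alpha> u) = 0"
proof -
  define y where "y = data_ratio \<alpha> u"
  note l = locint_eval_terms[OF assms(1)]
  have eq: "source \<alpha> u = (\<lambda>x. y powr (2/q - 1) * ((\<kappa> * (lam x + t)\<^sup>2 * u x powr (q - 1) - \<kappa> * (lam x + \<gamma>)\<^sup>2 * u x powr (- q - 1))
      - (y\<^sup>2 * u x powr (- q - 1) + 2 * \<kappa> * \<alpha> * y * ((lam x + \<gamma>) * u x powr (- q - 1)))))"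
    by (simp add: fun_eq_iff source_def y_def algebra_simps)
  have A: "coefA u = mid_int (\<lambda>x. \<kappa> * (lam x + t)\<^sup>2 * u x powr (q - 1) - \<kappa> * (lam x + \<gamma>)\<^sup>2 * u x powr (- q - 1))"
    by (simp add: coefA_def add.commute)
  have "mid_int (source \<alpha> u) = y powr (2/q - 1) * (coefA u - (y\<^sup>2 * coefC u + y * coefB \<alpha> u))"
    unfolding eq A coefB_def coefC_def
    by (simp add: ibint_cmult ibint_diff ibint_add locint_diff locint_add locint_cmult l)
  then show ?thesis
    using data_ratio_root(1)[OF assms, of \<alpha>] by (simp add: y_def algebra_simps)
qed

lemma exists_solution:
  "\<exists>\<epsilon>>0. \<exists>m>0. \<forall>\<delta> \<alpha>. \<bar>\<delta>\<bar> \<le> \<epsilon> \<and> \<alpha> \<in> dirs \<longrightarrow>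
    (\<exists>u C. u \<in> half_ball \<and> data_ratio \<alpha> u \<ge> m \<and> symmetric_source (source \<alpha> u) C \<and>
      (\<forall>x. apply_bcontfun u x = 1 + \<delta> * antideriv2 (source \<alpha> u) x))"
proof -
  obtain r c where r: "0 < r" "r \<le> 1 / 2" and c: "c > 0" "\<And>u. u \<in> cball unit_fn r \<Longrightarrow> c \<le> coefA u"
    by (rule coefA_lower) blast
  have sub: "cball unit_fn r \<subseteq> half_ball" using r(2) by auto
  note BLy = BL_data_ratio(1)[OF r(2) c]
  obtain m where m: "m > 0" "\<And>\<alpha> u. \<alpha> \<in> dirs \<Longrightarrow> u \<in> cball unit_fn r \<Longrightarrow> m \<le> data_ratio \<alpha> u"
    using BL_data_ratio(2)[OF r(2) c] by blast
  have BLy': "BL (dirs \<times> UNIV) (cball unit_fn r) (\<lambda>i. data_ratio (fst i))"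
    by (rule BL_reindex[OF BLy]) auto
  have BLa: "BL (dirs \<times> UNIV) X (\<lambda>i u. fst i)" for X :: "(real \<Rightarrow>\<^sub>C real) set"
    by (rule BL_const[where C = "sqrt (1 / \<kappa>)"]) (auto simp: dirs_bound)
  note ev = BL_subset[OF _ sub]
  have BLs: "BL (dirs \<times> UNIV) (cball unit_fn r) (\<lambda>(\<alpha>, x) u. source \<alpha> u x)"
  proof -
    have "BL (dirs \<times> UNIV) (cball unit_fn r) (\<lambda>i u. data_ratio (fst i) u powr (2 / q - 1) *
     (\<kappa> * (lam (snd i) + t)\<^sup>2 * apply_bcontfun u (snd i) powr (q - 1)
      - (data_ratio (fst i) u * data_ratio (fst i) u + (2 * \<kappa>) * (fst i * (data_ratio (fst i) u * (lam (snd i) + \<gamma>))) + \<kappa> * ((lam (snd i) + \<gamma>) * (lam (snd i) + \<gamma>))) * apply_bcontfun u (snd i) powr (- q - 1)))"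
      using m by (intro BL_mult[OF BL_powr[OF BLy' m(1)]] BL_diff ev[OF BL_eval_terms(3)] BL_mult[OF _ ev[OF BL_eval_powr]]
          BL_add BL_cmult BL_mult BLy' BLa BL_lam) auto
    then show ?thesis
      by (rule BL_cong) (auto simp: source_def power2_eq_square algebra_simps)
  qed
  obtain M where M: "\<And>i u. i \<in> dirs \<times> UNIV \<Longrightarrow> u \<in> cball unit_fn r \<Longrightarrow> \<bar>(\<lambda>(\<alpha>, x) u. source \<alpha> u x) i u\<bar> \<le> M"
    using BLs by (rule BL_E) blast
  obtain \<epsilon> where \<epsilon>: "\<epsilon> > 0" "\<And>\<delta> \<alpha>. \<bar>\<delta>\<bar> \<le> \<epsilon> \<Longrightarrow> \<alpha> \<in> dirs \<Longrightarrow>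
    (\<exists>u\<in>cball unit_fn r. \<forall>x. apply_bcontfun u x = 1 + \<delta> * antideriv2 (source \<alpha> u) (arcsin (sin x)))"
    using antideriv2_fixed_point[OF r(1) BLs] locint_source sub by blast
  have "\<exists>u C. u \<in> half_ball \<and> data_ratio \<alpha> u \<ge> m \<and> symmetric_source (source \<alpha> u) C \<and>
      (\<forall>x. apply_bcontfun u x = 1 + \<delta> * antideriv2 (source \<alpha> u) x)"
    if \<delta>: "\<bar>\<delta>\<bar> \<le> \<epsilon>" "\<alpha> \<in> dirs" for \<delta> \<alpha>
  proof -
    obtain u where u: "u \<in> cball unit_fn r" and eq: "\<And>x. apply_bcontfun u x = 1 + \<delta> * antideriv2 (source \<alpha> u) (arcsin (sin x))"
      using \<epsilon>(2)[OF \<delta>] by blast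
    have h: "u \<in> half_ball" "coefA u > 0" using u sub c(1) c(2)[OF u] by auto
    interpret symmetric_source "source \<alpha> u" M
    proof
      show "locint (source \<alpha> u)" by (rule locint_source[OF h(1)])
      show "\<bar>source \<alpha> u x\<bar> \<le> M" for x using M[of "(\<alpha>, x)" u] \<delta>(2) u by simp
      \<comment> \<open>The fixed point depends on x only through sin x and so inherits the
        symmetries of sin. The source then has them too, and only now can
        \<open>arcsin (sin x)\<close> be replaced by x.\<close>
      have "apply_bcontfun u (pi - x) = apply_bcontfun u x" "apply_bcontfun u (x + 2 * pi) = apply_bcontfun u x" for x
        by (simp_all add: eq)
      then show "source \<alpha> u (pi - x) = source \<alpha> u x" "source \<alpha> u (x + 2 * pi) = source \<alpha> u x" for x
        by (simp_all add: source_def lam_reflect lam_periodic)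
      show "mid_int (source \<alpha> u) = 0" by (rule source_mean[OF h])
    qed
    have "symmetric_source (source \<alpha> u) M" ..
    then show ?thesis using h m(2)[OF \<delta>(2) u] eq antideriv2_arcsin_sin by metis
  qed
  then show ?thesis using \<epsilon>(1) m(1) by blast
qed

end

section \<open>Recovering the solution\<close>

lemma W1p_S1_I:
  assumes "locint v" "locint (\<lambda>x. (v x)\<^sup>2)" "\<And>x. v (x + 2 * pi) = v x"
    and "\<And>x. w (x + 2 * pi) = w x" "\<And>x. w x = w 0 + ibint 0 x v"
  shows "W1p_S1 2 w v"
proof -
  have "v \<in> borel_measurable lborel"
    using locint_measurable[OF assms(1)] by simp
  moreover have "set_integrable lborel {-pi..pi} (\<lambda>x. \<bar>v x\<bar> powr 2)"
    using locint_Icc[OF assms(2)] by (simp add: powr_numeral)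
  moreover have "\<forall>x. w x = w 0 + (LBINT s=0..x. v s)"
    by (intro allI) (rule assms(5)[unfolded ibint_def, folded zero_ereal_def])
  ultimately show ?thesis
    unfolding W1p_S1_def Lp_S1_def periodic2pi_def using assms(3,4) by blast
qed

section \<open>Solving the momentum equation in weak form\<close>

lemma smooth_fun_C1:
  assumes "smooth_fun f"
  shows "(f has_real_derivative deriv f x) (at x)" "continuous_on UNIV f" "continuous_on UNIV (deriv f)"
proof -
  have "f differentiable at x" "deriv f differentiable at x" for x
    using assms[unfolded smooth_fun_def, rule_format, of 0] assms[unfolded smooth_fun_def, rule_format, of 1]
    by simp_all
  then show "(f has_real_derivative deriv f x) (at x)" "continuous_on UNIV f" "continuous_on UNIV (deriv f)"
    by (auto simp: DERIV_deriv_iff_real_differentiable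
        intro!: continuous_at_imp_continuous_on differentiable_imp_continuous_within)
qed

lemma lam_gamma_bound: "\<bar>lam x + c\<bar> \<le> 1 + \<bar>c\<bar>"
  using abs_lam_le[of x] by linarith

text \<open>gamma_N is the constant that makes N (lambda + gamma_N) mean free, so that a multiple of
  it can be the derivative of a periodic w.\<close>

lemma gammaN_balance:
  assumes "continuous_on UNIV N" "\<And>x. N x > 0"
  shows "ibint (- pi) pi (\<lambda>x. N x * (lam x + gammaN N)) = 0"
proof -
  have N: "locint N" by (rule locint_continuous[OF assms(1)])
  have NL: "locint (\<lambda>x. lam x * N x)"
    using locint_cont_mult[OF assms(1) lam_measurable abs_lam_le] by (simp add: mult.commute)
  \<comment> \<open>The minimum of N over the period bounds its integral, the denominator of
    gamma_N, away from zero.\<close>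
  have "\<exists>x0\<in>{-pi..pi}. \<forall>x\<in>{-pi..pi}. N x0 \<le> N x"
    by (rule continuous_attains_inf) (auto intro: continuous_on_subset[OF assms(1)])
  then obtain x0 where x0: "\<And>x. x \<in> {-pi..pi} \<Longrightarrow> N x0 \<le> N x" by blast
  have "0 < N x0 * (pi - - pi)" using assms(2) by simp
  also have "\<dots> = ibint (- pi) pi (\<lambda>x. N x0)" by (simp add: ibint_const)
  also have "\<dots> \<le> ibint (- pi) pi N"
    using x0 by (intro ibint_mono N locint_continuous) auto
  finally have pos: "ibint (- pi) pi N > 0" .
  have g: "gammaN N = - ibint (- pi) pi (\<lambda>x. lam x * N x) / ibint (- pi) pi N"
    by (simp add: gammaN_def ibint_eq_integral N NL)
  have "ibint (- pi) pi (\<lambda>x. N x * (lam x + gammaN N))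
      = ibint (- pi) pi (\<lambda>x. lam x * N x + gammaN N * N x)"
    by (simp add: algebra_simps)
  also have "\<dots> = ibint (- pi) pi (\<lambda>x. lam x * N x) + gammaN N * ibint (- pi) pi N"
    by (simp add: ibint_add ibint_cmult N NL locint_cmult)
  also have "\<dots> = 0" using pos by (simp add: g)
  finally show ?thesis .
qed

text \<open>D (lambda + gamma) is constant on each half circle and jumps by 2 D at 0 and by -2 D at
  pi, so only endpoint values of psi remain; gamma drops out because psi(-pi) = psi(pi).\<close>

lemma momentum_weak_form:
  assumes "smooth_fun \<psi>" "periodic2pi \<psi>"
  shows "- ibint (- pi) pi (\<lambda>x. D * (lam x + \<gamma>) * deriv \<psi> x) = 2 * D * \<psi> 0 - 2 * D * \<psi> pi"
proof -
  note C1 = smooth_fun_C1[OF assms(1)]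
  have "\<psi> (- pi) = \<psi> pi"
    using assms(2)[unfolded periodic2pi_def, rule_format, of "- pi"] by simp
  have FTC: "ibint a b (\<lambda>x. c * deriv \<psi> x) = c * (\<psi> b - \<psi> a)" if "a \<le> b" for a b c
    by (simp add: ibint_cmult ibint_FTC[OF that C1(1,3)])
  have "locint (\<lambda>x. deriv \<psi> x * (D * (lam x + \<gamma>)))"
    by (rule locint_cont_mult[OF C1(3), where C = "\<bar>D\<bar> * (1 + \<bar>\<gamma>\<bar>)"])
      (auto simp: abs_mult intro!: mult_left_mono lam_gamma_bound)
  then have int: "locint (\<lambda>x. D * (lam x + \<gamma>) * deriv \<psi> x)" by (simp add: mult_ac)
  have "ibint (- pi) 0 (\<lambda>x. D * (lam x + \<gamma>) * deriv \<psi> x) = ibint (- pi) 0 (\<lambda>x. D * (- 1 + \<gamma>) * deriv \<psi> x)"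
    by (rule ibint_cong) (use sin_gt_zero[of "- x" for x] in \<open>force simp: lam_def\<close>)
  moreover have "ibint 0 pi (\<lambda>x. D * (lam x + \<gamma>) * deriv \<psi> x) = ibint 0 pi (\<lambda>x. D * (1 + \<gamma>) * deriv \<psi> x)"
    by (rule ibint_cong) (simp add: lam_def sin_gt_zero)
  ultimately have "ibint (- pi) pi (\<lambda>x. D * (lam x + \<gamma>) * deriv \<psi> x)
      = D * (- 1 + \<gamma>) * (\<psi> 0 - \<psi> (- pi)) + D * (1 + \<gamma>) * (\<psi> pi - \<psi> 0)"
    using ibint_concat[OF int, of "- pi" 0 pi] by (simp add: FTC)
  then show ?thesis
    unfolding \<open>\<psi> (- pi) = \<psi> pi\<close> by (simp add: algebra_simps)
qed

text \<open>Pointwise algebra behind phi = d U, applied with A = kappa tau^2 and L = lambda + gamma.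
  Since d^q = D and M = y D, all terms share the factor D / d. Eliminating eta through the formula
  for M^2 turns the coefficient of the negative power into D^2 (y^2 + 2 kappa alpha y L + kappa
  L^2).\<close>

lemma Lichnerowicz_rescaling:
  fixes \<kappa> q \<mu> \<eta> M y U A L :: real
  assumes q: "q > 2" and pos: "M > 0" "y > 0" "U > 0"
    and M: "M\<^sup>2 = \<kappa> * \<mu>\<^sup>2 + 2 * \<eta>\<^sup>2" and \<alpha>: "\<alpha> = \<mu> / M" and D: "D = M / y" and d: "d = D powr (1 / q)"
  shows "- (M powr (1 - 2 / q) * d * (y powr (2 / q - 1) *
       (A * U powr (q - 1) - (y\<^sup>2 + 2 * \<kappa> * \<alpha> * y * L + \<kappa> * L\<^sup>2) * U powr (- q - 1))))
     - 2 * \<eta>\<^sup>2 * (d * U) powr (- q - 1) - \<kappa> * (\<mu> + D * L)\<^sup>2 * (d * U) powr (- q - 1)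
     + A * (d * U) powr (q - 1) = 0"
proof -
  have Dp: "D > 0" using pos D by simp
  then have dp: "d > 0" by (simp add: d)
  have dq: "d powr q = D" using q Dp by (simp add: d powr_powr)
  have e1: "d powr (q - 1) = D / d" using dp by (simp add: powr_diff dq)
  have e2: "d powr (- q - 1) = 1 / (D * d)" using dp by (simp add: powr_diff powr_minus dq divide_simps)
  have "M powr (1 - 2 / q) * y powr (2 / q - 1) = M powr (1 - 2 / q) / y powr (1 - 2 / q)"
    using pos powr_minus[of y "1 - 2 / q"] by (simp add: field_simps)
  also have "\<dots> = D powr (1 - 2 / q)"
    using pos by (simp add: D powr_divide)
  also have "\<dots> = D / (d * d)"
    using Dp by (simp add: d powr_diff flip: powr_add)
  finally have e3: "M powr (1 - 2 / q) * y powr (2 / q - 1) = D / (d * d)" .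
  have \<mu>: "\<mu> = \<alpha> * y * D" using pos by (simp add: \<alpha> D)
  have "M = y * D" using pos by (simp add: D)
  then have \<eta>: "2 * \<eta>\<^sup>2 = D\<^sup>2 * y\<^sup>2 - \<kappa> * (\<alpha> * y * D)\<^sup>2"
    using M by (simp add: \<mu> power_mult_distrib algebra_simps)
  have "M powr (1 - 2 / q) * d * (y powr (2 / q - 1) *
       (A * U powr (q - 1) - (y\<^sup>2 + 2 * \<kappa> * \<alpha> * y * L + \<kappa> * L\<^sup>2) * U powr (- q - 1)))
    = (M powr (1 - 2 / q) * y powr (2 / q - 1)) * d *
       (A * U powr (q - 1) - (y\<^sup>2 + 2 * \<kappa> * \<alpha> * y * L + \<kappa> * L\<^sup>2) * U powr (- q - 1))"
    by simp
  also have "\<dots> = D / d * (A * U powr (q - 1) - (y\<^sup>2 + 2 * \<kappa> * \<alpha> * y * L + \<kappa> * L\<^sup>2) * U powr (- q - 1))"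
    using dp by (simp add: e3)
  finally have 1: "M powr (1 - 2 / q) * d * (y powr (2 / q - 1) *
       (A * U powr (q - 1) - (y\<^sup>2 + 2 * \<kappa> * \<alpha> * y * L + \<kappa> * L\<^sup>2) * U powr (- q - 1)))
    = D / d * (A * U powr (q - 1) - (y\<^sup>2 + 2 * \<kappa> * \<alpha> * y * L + \<kappa> * L\<^sup>2) * U powr (- q - 1))" .
  have "2 * \<eta>\<^sup>2 + \<kappa> * (\<mu> + D * L)\<^sup>2 = D\<^sup>2 * (y\<^sup>2 + 2 * \<kappa> * \<alpha> * y * L + \<kappa> * L\<^sup>2)"
    unfolding \<eta> \<mu> by (simp add: power2_eq_square algebra_simps)
  moreover have "(d * U) powr (- q - 1) = 1 / (D * d) * U powr (- q - 1)"
    using dp pos by (simp add: powr_mult e2)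
  ultimately have "2 * \<eta>\<^sup>2 * (d * U) powr (- q - 1) + \<kappa> * (\<mu> + D * L)\<^sup>2 * (d * U) powr (- q - 1)
    = D\<^sup>2 * (y\<^sup>2 + 2 * \<kappa> * \<alpha> * y * L + \<kappa> * L\<^sup>2) * (1 / (D * d) * U powr (- q - 1))"
    by (simp only: flip: distrib_right)
  also have "\<dots> = D / d * ((y\<^sup>2 + 2 * \<kappa> * \<alpha> * y * L + \<kappa> * L\<^sup>2) * U powr (- q - 1))"
    using Dp dp by (simp add: power2_eq_square)
  finally have 2: "2 * \<eta>\<^sup>2 * (d * U) powr (- q - 1) + \<kappa> * (\<mu> + D * L)\<^sup>2 * (d * U) powr (- q - 1)
    = D / d * ((y\<^sup>2 + 2 * \<kappa> * \<alpha> * y * L + \<kappa> * L\<^sup>2) * U powr (- q - 1))" .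
  have 3: "A * (d * U) powr (q - 1) = D / d * (A * U powr (q - 1))"
    using dp pos by (simp add: powr_mult e1)
  show ?thesis
    using 1 2 3 unfolding right_diff_distrib by linarith
qed

section \<open>Existence for small mu and eta\<close>

theorem theorem3p3:
  fixes n :: nat and t :: real and N :: "real \<Rightarrow> real"
  assumes "n \<ge> 3"
    and "smooth_fun N" and "periodic2pi N" and "\<forall>x. N x > 0"
    and "\<bar>t\<bar> > \<bar>gammaN N\<bar>" and "\<bar>t\<bar> \<noteq> 1"
  shows "\<exists>\<epsilon>>0. \<forall>\<eta> \<mu>. (\<mu> \<noteq> 0 \<or> \<eta> \<noteq> 0) \<and> \<bar>\<mu>\<bar> < \<epsilon> \<and> \<bar>\<eta>\<bar> < \<epsilon> \<longrightarrow>
           (\<exists>phi w. is_solution n t N \<eta> \<mu> phi w)"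
proof -
  define \<kappa> where "\<kappa> = (real n - 1) / real n"
  define q where "q = 2 * real n / (real n - 2)"
  define \<gamma> where "\<gamma> = gammaN N"
  have \<kappa>: "\<kappa> > 0" using assms(1) by (simp add: \<kappa>_def)
  have q: "q > 2" using assms(1) by (simp add: q_def field_simps)
  interpret rescaled_system \<kappa> q t \<gamma>
    using \<kappa> q assms(5) by unfold_locales (simp_all add: \<gamma>_def)
  have N: "continuous_on UNIV N" by (rule smooth_fun_C1(2)[OF assms(2)])
  have Nper: "N (x + 2 * pi) = N x" for x using assms(3) by (simp add: periodic2pi_def)
  obtain \<epsilon>\<^sub>0 m where \<epsilon>\<^sub>0: "\<epsilon>\<^sub>0 > 0" and m: "m > 0" and sol: "\<And>\<delta> \<alpha>. \<bar>\<delta>\<bar> \<le> \<epsilon>\<^sub>0 \<Longrightarrow> \<alpha> \<in> dirs \<Longrightarrow>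
    \<exists>u C. u \<in> half_ball \<and> data_ratio \<alpha> u \<ge> m \<and> symmetric_source (source \<alpha> u) C \<and>
      (\<forall>x. apply_bcontfun u x = 1 + \<delta> * antideriv2 (source \<alpha> u) x)"
    using exists_solution by blast
  define s where "s = 1 - 2 / q"
  have s: "s > 0" using q by (simp add: s_def)
  \<comment> \<open>The value of M at which delta = M^s / (2 kappa q) reaches the threshold
    \<open>\<epsilon>\<^sub>0\<close>.\<close>
  define M\<^sub>0 where "M\<^sub>0 = (2 * \<kappa> * q * \<epsilon>\<^sub>0) powr (1 / s)"
  have M\<^sub>0: "M\<^sub>0 > 0" using \<kappa> q \<epsilon>\<^sub>0 by (simp add: M\<^sub>0_def)
  \<comment> \<open>If |mu| and |eta| are below epsilon, then M is at most sqrt (kappa + 2) epsilon,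
    that is \<open>M\<^sub>0\<close>.\<close>
  define \<epsilon> where "\<epsilon> = M\<^sub>0 / sqrt (\<kappa> + 2)"
  have \<epsilon>: "\<epsilon> > 0" using M\<^sub>0 \<kappa> by (simp add: \<epsilon>_def)
  show ?thesis
  proof (intro exI[of _ \<epsilon>] conjI \<epsilon> allI impI; elim conjE)
    fix \<eta> \<mu> :: real
    assume nz: "\<mu> \<noteq> 0 \<or> \<eta> \<noteq> 0" and small: "\<bar>\<mu>\<bar> < \<epsilon>" "\<bar>\<eta>\<bar> < \<epsilon>"
    define M where "M = sqrt (\<kappa> * \<mu>\<^sup>2 + 2 * \<eta>\<^sup>2)"
    have M2: "M\<^sup>2 = \<kappa> * \<mu>\<^sup>2 + 2 * \<eta>\<^sup>2" using \<kappa> by (simp add: M_def)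
    have "\<kappa> * \<mu>\<^sup>2 + 2 * \<eta>\<^sup>2 > 0"
      using nz \<kappa> by (auto intro: add_pos_nonneg add_nonneg_pos)
    then have M: "M > 0" by (simp add: M_def)
    have "\<mu>\<^sup>2 \<le> \<epsilon>\<^sup>2" "\<eta>\<^sup>2 \<le> \<epsilon>\<^sup>2" using small by (auto simp: abs_le_square_iff[symmetric])
    then have "\<kappa> * \<mu>\<^sup>2 + 2 * \<eta>\<^sup>2 \<le> \<kappa> * \<epsilon>\<^sup>2 + 2 * \<epsilon>\<^sup>2"
      using \<kappa> by (intro add_mono mult_left_mono) auto
    then have "M \<le> sqrt ((\<kappa> + 2) * \<epsilon>\<^sup>2)"
      unfolding M_def by (intro real_sqrt_le_mono) (simp add: distrib_right)
    also have "\<dots> = M\<^sub>0" using M\<^sub>0 \<kappa> by (simp add: real_sqrt_mult \<epsilon>_def)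
    finally have MM\<^sub>0: "M \<le> M\<^sub>0" .
    define \<delta> where "\<delta> = M powr s / (2 * \<kappa> * q)"
    have "M powr s \<le> M\<^sub>0 powr s" using MM\<^sub>0 M s by (intro powr_mono2) auto
    also have "\<dots> = 2 * \<kappa> * q * \<epsilon>\<^sub>0" using s \<kappa> q \<epsilon>\<^sub>0 by (simp add: M\<^sub>0_def powr_powr)
    finally have \<delta>\<epsilon>: "\<bar>\<delta>\<bar> \<le> \<epsilon>\<^sub>0" using \<kappa> q by (simp add: \<delta>_def field_simps)
    define \<alpha> where "\<alpha> = \<mu> / M"
    have "\<kappa> * \<mu>\<^sup>2 \<le> M\<^sup>2" by (simp add: M2)
    then have "\<alpha> \<in> dirs" using M by (simp add: dirs_def \<alpha>_def power_divide)
    then obtain u C where u: "u \<in> half_ball" and y: "data_ratio \<alpha> u \<ge> m"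
      and src: "symmetric_source (source \<alpha> u) C"
      and ueq: "\<And>x. apply_bcontfun u x = 1 + \<delta> * antideriv2 (source \<alpha> u) x"
      using sol[OF \<delta>\<epsilon>] by blast
    interpret symmetric_source "source \<alpha> u" C by (rule src)
    define y where "y = data_ratio \<alpha> u"
    have ypos: "y > 0" using y m by (simp add: y_def)
    define D where "D = M / y"
    define d where "d = D powr (1 / q)"
    have D: "D > 0" using M ypos by (simp add: D_def)
    have d: "d > 0" using D by (simp add: d_def)
    have upos: "apply_bcontfun u x > 0" for x using cball_unit_fn(1)[OF u, of x] by linarith
    define \<phi> where "\<phi> x = d * apply_bcontfun u x" for x
    define g where "g x = d * \<delta> * antideriv1 (source \<alpha> u) x" for x
    define h where "h x = d * \<delta> * source \<alpha> u x" for x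
    \<comment> \<open>Dictated by the momentum equation: w' / (2 N) must be D (lambda + gamma),
      where D will be phi(0)^q.\<close>
    define v where "v x = 2 * D * (N x * (lam x + \<gamma>))" for x
    define w where "w x = ibint 0 x v" for x
    have vN: "v x / (2 * N x) = D * (lam x + \<gamma>)" for x
      using assms(4) less_imp_neq[of 0 "N x"] by (simp add: v_def)
    have "W1p_S1 2 g h"
    proof (rule W1p_S1_I)
      show "locint h" unfolding h_def[abs_def] by (rule locint_cmult[OF int])
      have "locint (\<lambda>x. (d * \<delta>)\<^sup>2 * (source \<alpha> u x)\<^sup>2)"
      proof (rule locint_cont_mult[OF continuous_on_const])
        show "(\<lambda>x. (source \<alpha> u x)\<^sup>2) \<in> borel_measurable borel"
          using locint_measurable[OF int] by measurable
        show "\<bar>(source \<alpha> u x)\<^sup>2\<bar> \<le> C\<^sup>2" for x using bd[of x] by (simp add: abs_le_square_iff[symmetric])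
      qed
      then show "locint (\<lambda>x. (h x)\<^sup>2)" by (simp add: h_def power_mult_distrib)
      show "h (x + 2 * pi) = h x" for x by (simp add: h_def per)
      show "g (x + 2 * pi) = g x" for x by (simp add: g_def antideriv1_periodic)
      show "g x = g 0 + ibint 0 x h" for x
        unfolding g_def h_def[abs_def] ibint_cmult distrib_left[symmetric] antideriv1_def
        by (simp only: ibint_concat[OF int])
    qed
    moreover have "\<phi> (x + 2 * pi) = \<phi> x" for x by (simp add: \<phi>_def ueq antideriv2_periodic)
    moreover have "(\<phi> has_real_derivative g x) (at x)" for x
    proof -
      have "((\<lambda>x. d * (1 + \<delta> * antideriv2 (source \<alpha> u) x)) has_real_derivative g x) (at x)"
        unfolding g_def by (auto intro!: derivative_eq_intros antideriv2_has_derivative[OF int bd])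
      then show ?thesis by (simp add: \<phi>_def[abs_def] ueq)
    qed
    ultimately have W2: "W2p_S1 2 \<phi> g h" by (simp add: W2p_S1_def periodic2pi_def)
    have lg: "(\<lambda>x. lam x + \<gamma>) \<in> borel_measurable borel" by measurable
    have v_int: "locint v"
      unfolding v_def[abs_def] by (intro locint_cmult locint_cont_mult[OF N lg lam_gamma_bound])
    have W1: "W1p_S1 2 w v"
    proof (rule W1p_S1_I[OF v_int])
      have "locint (\<lambda>x. (2 * D)\<^sup>2 * ((N x)\<^sup>2 * (lam x + \<gamma>)\<^sup>2))"
      proof (intro locint_cmult locint_cont_mult)
        show "continuous_on UNIV (\<lambda>x. (N x)\<^sup>2)" using N by (intro continuous_intros)
        show "(\<lambda>x. (lam x + \<gamma>)\<^sup>2) \<in> borel_measurable borel" by measurable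
        show "\<bar>(lam x + \<gamma>)\<^sup>2\<bar> \<le> (1 + \<bar>\<gamma>\<bar>)\<^sup>2" for x
          using lam_gamma_bound[of x \<gamma>] by (simp add: abs_le_square_iff[symmetric])
      qed
      then show "locint (\<lambda>x. (v x)\<^sup>2)" by (simp add: v_def power_mult_distrib)
      show vper: "v (x + 2 * pi) = v x" for x by (simp add: v_def Nper lam_periodic)
      have "ibint (- pi) pi v = 0"
        unfolding v_def[abs_def] ibint_cmult using gammaN_balance[OF N] assms(4) by (simp add: \<gamma>_def)
      then show "w (x + 2 * pi) = w x" for x
        unfolding w_def by (rule ibint_periodic[OF v_int vper])
      show "w x = w 0 + ibint 0 x v" for x by (simp add: w_def ibint_same)
    qed
    have eq1: "- 2 * \<kappa> * q * h x - 2 * \<eta>\<^sup>2 * \<phi> x powr (- q - 1)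
          - \<kappa> * (\<mu> + v x / (2 * N x))\<^sup>2 * \<phi> x powr (- q - 1)
          + \<kappa> * (tau t x)\<^sup>2 * \<phi> x powr (q - 1) = 0" for x
    proof -
      \<comment> \<open>delta was chosen so that 2 kappa q delta = M^(1 - 2/q).\<close>
      have "2 * \<kappa> * q * h x = M powr (1 - 2 / q) * d * source \<alpha> u x"
        using \<kappa> q by (simp add: h_def \<delta>_def s_def)
      then show ?thesis
        using Lichnerowicz_rescaling[OF q M ypos upos[of x] M2 \<alpha>_def D_def d_def,
            of "\<kappa> * (t + lam x)\<^sup>2" "lam x + \<gamma>"]
        by (simp add: \<phi>_def vN tau_def source_def y_def)
    qed
    \<comment> \<open>Equal values at 0 and pi let the single constant D = d^q match both point
      masses of tau'.\<close>
    have "\<phi> 0 = d" by (simp add: \<phi>_def ueq antideriv2_def ibint_same)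
    moreover have "\<phi> pi = d" using antideriv2_reflect[of 0] by (simp add: \<phi>_def ueq antideriv2_def ibint_same)
    moreover have "d powr q = D" using q D by (simp add: d_def powr_powr)
    ultimately have eq2: "- (LBINT x=-pi..pi. v x / (2 * N x) * deriv \<psi> x)
            = 2 * \<phi> 0 powr q * \<psi> 0 - 2 * \<phi> pi powr q * \<psi> pi"
      if "smooth_fun \<psi>" "periodic2pi \<psi>" for \<psi>
      using momentum_weak_form[OF that, of D \<gamma>] by (simp add: vN ibint_def)
    have "is_solution n t N \<eta> \<mu> \<phi> w"
      unfolding is_solution_def Let_def \<kappa>_def[symmetric] q_def[symmetric]
    \<comment> \<open>The exponent p = 2 is admissible because phi'' and w' are bounded.\<close>
    proof (rule exI[of _ 2], intro conjI, simp, rule exI[of _ g], rule exI[of _ h], rule exI[of _ v], intro conjI)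
      show "\<forall>x. \<phi> x > 0" using d upos by (simp add: \<phi>_def)
      show "AE x in lborel. - 2 * \<kappa> * q * h x - 2 * \<eta>\<^sup>2 * \<phi> x powr (- q - 1)
          - \<kappa> * (\<mu> + v x / (2 * N x))\<^sup>2 * \<phi> x powr (- q - 1)
          + \<kappa> * (tau t x)\<^sup>2 * \<phi> x powr (q - 1) = 0"
        by (intro AE_I2 eq1)
    qed (use W1 W2 eq2 in blast)+
    then show "\<exists>phi w. is_solution n t N \<eta> \<mu> phi w" by blast
  qed
qed

end
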